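(* Let $\mathscr{E}$ be a topos such that for every ring object $A$, right $A$-module $M$ and left $A$-module $N$ the functor $\mathrm{Ab}(\mathscr{E})\to\mathrm{Ab}$, $P\mapsto\mathrm{Hom}_A(M,[N,P]_{\mathbf Z})$ is representable. Let $A$ be a ring object in $\mathscr{E}$, $M$ a right $A$-module and $N$ a left $A$-module. For every abelian group object $P$ and every balanced product $f:M\times N\to P$, there is a unique group homomorphism $\tilde f:M\otimes_AN\to P$ such that $\tilde f\circ\otimes=f$.
   Context: $\mathrm{Ab}(\mathscr{E})$ is the category of abelian group objects in $\mathscr{E}$ and $\mathrm{Hom}_{\mathbf Z}$ its hom-groups. For abelian group objects $N,P$, $[N,P]_{\mathbf Z}$ is the subobject of the topos internal hom $[N,P]$ given in the internal language by $\{f\mid\forall n,n'{:}N\,(f(n+n')=f(n)+f(n'))\}$; it is an abelian group object, and if $N$ is a left $A$-module it is a right $A$-module via $(fa)(n)=f(an)$. The tensor product $M\otimes_AN\in\mathrm{Ab}(\mathscr{E})$ is the representing object: $\mathrm{Hom}_{\mathbf Z}(M\otimes_AN,P)\cong\mathrm{Hom}_A(M,[N,P]_{\mathbf Z})$, naturally in $P$. The morphism $\otimes:M\times N\to M\otimes_AN$ in $\mathscr{E}$ is the transpose (under $\mathscr{E}(M,[N,M\otimes_AN])\cong\mathscr{E}(M\times N,M\otimes_AN)$) of the unit $\eta_M:M\to[N,M\otimes_AN]_{\mathbf Z}\rightarrowtail[N,M\otimes_AN]$. A morphism $f:M\times N\to P$ in $\mathscr{E}$, with $P$ an abelian group object,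 is a balanced product if the following hold in the internal language: $f(m+m',n)=f(m,n)+f(m',n)$; $f(m,n+n')=f(m,n)+f(m,n')$; $f(ma,n)=f(m,an)$, for all $m,m'{:}M$, $n,n'{:}N$, $a{:}A$. *)

theory Defs
  imports "HOL-Algebra.Group"
begin

text \<open>Elementary toposes, with chosen finite limits, exponentials and subobject classifier.\<close>

record ('o, 'm) category_data =
  Ob :: "'o set"
  Ar :: "'m set"
  Dom :: "'m \<Rightarrow> 'o"
  Cod :: "'m \<Rightarrow> 'o"
  Id :: "'o \<Rightarrow> 'm"
  Comp :: "'m \<Rightarrow> 'm \<Rightarrow> 'm"  (infixl "\<cdot>\<index>" 75)

text \<open>
  \<open>Pb1 f g\<close> and \<open>Pb2 f g\<close> are the two legs of the chosen pullback of the cospan \<open>(f, g)\<close>.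
  \<open>Exp N P\<close> is the internal hom $[N,P]$ (exponent first), with evaluation
  \<open>Ev N P : [N,P] \<times> N \<rightarrow> P\<close>.
\<close>

record ('o, 'm) topos_data = "('o, 'm) category_data" +
  One :: "'o"
  Prod :: "'o \<Rightarrow> 'o \<Rightarrow> 'o"  (infixl "\<^bold>\<times>\<index>" 80)
  Fst :: "'o \<Rightarrow> 'o \<Rightarrow> 'm"
  Snd :: "'o \<Rightarrow> 'o \<Rightarrow> 'm"
  Pb1 :: "'m \<Rightarrow> 'm \<Rightarrow> 'm"
  Pb2 :: "'m \<Rightarrow> 'm \<Rightarrow> 'm"
  Exp :: "'o \<Rightarrow> 'o \<Rightarrow> 'o"
  Ev :: "'o \<Rightarrow> 'o \<Rightarrow> 'm"
  Omega :: "'o"  ("\<Omega>\<index>")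
  Truth :: "'m"  ("\<top>\<index>")

definition Hm :: "('o, 'm, 'e) category_data_scheme \<Rightarrow> 'o \<Rightarrow> 'o \<Rightarrow> 'm set" where
  "Hm E X Y = {f \<in> Ar E. Dom E f = X \<and> Cod E f = Y}"

locale category =
  fixes E :: "('o, 'm, 'e) category_data_scheme" (structure)
  assumes Dom_Ob: "f \<in> Ar E \<Longrightarrow> Dom E f \<in> Ob E"
    and Cod_Ob: "f \<in> Ar E \<Longrightarrow> Cod E f \<in> Ob E"
    and Id_Hm: "X \<in> Ob E \<Longrightarrow> Id E X \<in> Hm E X X"
    and Comp_Hm: "f \<in> Hm E X Y \<Longrightarrow> g \<in> Hm E Y Z \<Longrightarrow> g \<cdot> f \<in> Hm E X Z"
    and Comp_assoc:
      "f \<in> Hm E W X \<Longrightarrow> g \<in> Hm E X Y \<Longrightarrow> h \<in> Hm E Y Z \<Longrightarrow> (h \<cdot> g) \<cdot> f = h \<cdot> (g \<cdot> f)"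
    and Id_right: "f \<in> Hm E X Y \<Longrightarrow> f \<cdot> Id E X = f"
    and Id_left: "f \<in> Hm E X Y \<Longrightarrow> Id E Y \<cdot> f = f"
begin

definition is_terminal :: "'o \<Rightarrow> bool" where
  "is_terminal T \<longleftrightarrow> T \<in> Ob E \<and> (\<forall>X\<in>Ob E. \<exists>!t. t \<in> Hm E X T)"

definition is_product :: "'o \<Rightarrow> 'o \<Rightarrow> 'o \<Rightarrow> 'm \<Rightarrow> 'm \<Rightarrow> bool" where
  "is_product X Y Q p q \<longleftrightarrow> p \<in> Hm E Q X \<and> q \<in> Hm E Q Y \<and>
     (\<forall>Z f g. f \<in> Hm E Z X \<longrightarrow> g \<in> Hm E Z Y \<longrightarrow> (\<exists>!h. h \<in> Hm E Z Q \<and> p \<cdot> h = f \<and> q \<cdot> h = g))"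

definition is_pullback :: "'m \<Rightarrow> 'm \<Rightarrow> 'm \<Rightarrow> 'm \<Rightarrow> bool" where
  "is_pullback f g p q \<longleftrightarrow>
     (\<exists>Q X Y Z. f \<in> Hm E X Z \<and> g \<in> Hm E Y Z \<and> p \<in> Hm E Q X \<and> q \<in> Hm E Q Y \<and> f \<cdot> p = g \<cdot> q \<and>
       (\<forall>W u v. u \<in> Hm E W X \<longrightarrow> v \<in> Hm E W Y \<longrightarrow> f \<cdot> u = g \<cdot> v \<longrightarrow>
         (\<exists>!h. h \<in> Hm E W Q \<and> p \<cdot> h = u \<and> q \<cdot> h = v)))"

definition is_mono :: "'m \<Rightarrow> bool" where
  "is_mono m \<longleftrightarrow> m \<in> Ar E \<and>
     (\<forall>W u v. u \<in> Hm E W (Dom E m) \<longrightarrow> v \<in> Hm E W (Dom E m) \<longrightarrow> m \<cdot> u = m \<cdot> v \<longrightarrow> u = v)"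

end

locale finitely_complete_category = category E
  for E :: "('o, 'm) topos_data" (structure) +
  assumes One_terminal: "is_terminal (One E)"
    and Prod_product:
      "X \<in> Ob E \<Longrightarrow> Y \<in> Ob E \<Longrightarrow> is_product X Y (X \<^bold>\<times> Y) (Fst E X Y) (Snd E X Y)"
    and Pb_pullback:
      "f \<in> Hm E X Z \<Longrightarrow> g \<in> Hm E Y Z \<Longrightarrow> is_pullback f g (Pb1 E f g) (Pb2 E f g)"
begin

definition bang :: "'o \<Rightarrow> 'm" where
  "bang X = (THE t. t \<in> Hm E X (One E))"

definition pair :: "'m \<Rightarrow> 'm \<Rightarrow> 'm"  ("\<langle>_,/ _\<rangle>") where
  "\<langle>f, g\<rangle> = (THE h. h \<in> Hm E (Dom E f) (Cod E f \<^bold>\<times> Cod E g) \<and>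
                  Fst E (Cod E f) (Cod E g) \<cdot> h = f \<and> Snd E (Cod E f) (Cod E g) \<cdot> h = g)"

definition prod_map :: "'m \<Rightarrow> 'm \<Rightarrow> 'm" where
  "prod_map f g = \<langle>f \<cdot> Fst E (Dom E f) (Dom E g), g \<cdot> Snd E (Dom E f) (Dom E g)\<rangle>"

end

locale topos = finitely_complete_category E
  for E :: "('o, 'm) topos_data" (structure) +
  assumes Exp_Ob: "N \<in> Ob E \<Longrightarrow> P \<in> Ob E \<Longrightarrow> Exp E N P \<in> Ob E"
    and Ev_Hm: "N \<in> Ob E \<Longrightarrow> P \<in> Ob E \<Longrightarrow> Ev E N P \<in> Hm E (Exp E N P \<^bold>\<times> N) P"
    and Exp_universal:
      "X \<in> Ob E \<Longrightarrow> N \<in> Ob E \<Longrightarrow> f \<in> Hm E (X \<^bold>\<times> N) P \<Longrightarrow>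
        \<exists>!g. g \<in> Hm E X (Exp E N P) \<and> Ev E N P \<cdot> prod_map g (Id E N) = f"
    and Truth_Hm: "\<top> \<in> Hm E (One E) \<Omega>"
    and Omega_classifies:
      "is_mono m \<Longrightarrow>
        \<exists>!\<chi>. \<chi> \<in> Hm E (Cod E m) \<Omega> \<and> is_pullback \<chi> \<top> m (bang (Dom E m))"

text \<open>
  The fragment of the internal (Mitchell--Benabou) language built from equality and universal
  quantification, with de Bruijn variables.  A context is a list of objects, innermost variable
  first; \<open>Fn h t\<close> applies a morphism \<open>h\<close> to a term, \<open>App N P s t\<close> is the value of
  \<open>s : [N,P]\<close> at \<open>t : N\<close>.
\<close>

datatype ('o, 'm) tm =
    Var nat
  | Unit
  | Pair "('o, 'm) tm" "('o, 'm) tm"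
  | Fn 'm "('o, 'm) tm"
  | App 'o 'o "('o, 'm) tm" "('o, 'm) tm"

datatype ('o, 'm) fm =
    Eq "('o, 'm) tm" "('o, 'm) tm"
  | All 'o "('o, 'm) fm"

context topos
begin

definition curry :: "'o \<Rightarrow> 'o \<Rightarrow> 'o \<Rightarrow> 'm \<Rightarrow> 'm" where
  "curry X N P f =
     (THE g. g \<in> Hm E X (Exp E N P) \<and> Ev E N P \<cdot> prod_map g (Id E N) = f)"

definition char_map :: "'m \<Rightarrow> 'm" where
  "char_map m =
     (THE \<chi>. \<chi> \<in> Hm E (Cod E m) \<Omega> \<and> is_pullback \<chi> \<top> m (bang (Dom E m)))"

definition eq_pred :: "'o \<Rightarrow> 'm" where
  "eq_pred X = char_map \<langle>Id E X, Id E X\<rangle>"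

text \<open>
  The quantifier \<open>\<forall>\<^sub>X : [X,\<Omega>] \<rightarrow> \<Omega>\<close> is the characteristic map of the name
  \<open>1 \<rightarrow> [X,\<Omega>]\<close> of the maximal predicate on \<open>X\<close>.
\<close>

definition all_pred :: "'o \<Rightarrow> 'm" where
  "all_pred X = char_map (curry (One E) X \<Omega> (\<top> \<cdot> bang (One E \<^bold>\<times> X)))"

primrec ctx :: "'o list \<Rightarrow> 'o" where
  "ctx [] = One E"
| "ctx (X # \<Gamma>) = ctx \<Gamma> \<^bold>\<times> X"

fun var_sem :: "'o list \<Rightarrow> nat \<Rightarrow> 'm" where
  "var_sem (X # \<Gamma>) 0 = Snd E (ctx \<Gamma>) X"
| "var_sem (X # \<Gamma>) (Suc i) = var_sem \<Gamma> i \<cdot> Fst E (ctx \<Gamma>) X"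
| "var_sem [] _ = undefined"

primrec tm_sem :: "'o list \<Rightarrow> ('o, 'm) tm \<Rightarrow> 'm" where
  "tm_sem \<Gamma> (Var i) = var_sem \<Gamma> i"
| "tm_sem \<Gamma> Unit = bang (ctx \<Gamma>)"
| "tm_sem \<Gamma> (Pair s t) = \<langle>tm_sem \<Gamma> s, tm_sem \<Gamma> t\<rangle>"
| "tm_sem \<Gamma> (Fn h t) = h \<cdot> tm_sem \<Gamma> t"
| "tm_sem \<Gamma> (App N P s t) = Ev E N P \<cdot> \<langle>tm_sem \<Gamma> s, tm_sem \<Gamma> t\<rangle>"

primrec fm_sem :: "'o list \<Rightarrow> ('o, 'm) fm \<Rightarrow> 'm" where
  "fm_sem \<Gamma> (Eq s t) = eq_pred (Cod E (tm_sem \<Gamma> s)) \<cdot> \<langle>tm_sem \<Gamma> s, tm_sem \<Gamma> t\<rangle>"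
| "fm_sem \<Gamma> (All X \<phi>) = all_pred X \<cdot> curry (ctx \<Gamma>) X \<Omega> (fm_sem (X # \<Gamma>) \<phi>)"

definition valid :: "('o, 'm) fm \<Rightarrow> bool" where
  "valid \<phi> \<longleftrightarrow> fm_sem [] \<phi> = \<top>"

text \<open>
  \<open>compr X \<phi>\<close> is the inclusion of the subobject \<open>{x : X | \<phi>}\<close>.  The context \<open>[X]\<close> is
  interpreted as \<open>1 \<times> X\<close>, hence the precomposition with \<open>X \<rightarrow> 1 \<times> X\<close>.
\<close>

definition compr :: "'o \<Rightarrow> ('o, 'm) fm \<Rightarrow> 'm" where
  "compr X \<phi> = Pb1 E (fm_sem [X] \<phi> \<cdot> \<langle>bang X, Id E X\<rangle>) \<top>"

end

text \<open>
  Abelian group objects, ring objects (associative, unital, not necessarily commutative) and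
  modules.  The same record carries right modules (action \<open>M \<times> A \<rightarrow> M\<close>) and left modules
  (action \<open>A \<times> N \<rightarrow> N\<close>).
\<close>

record ('o, 'm) ab_obj =
  car :: 'o
  gadd :: 'm
  gzero :: 'm
  gneg :: 'm

record ('o, 'm) ring_obj = "('o, 'm) ab_obj" +
  rmul :: 'm
  runit :: 'm

record ('o, 'm) mod_obj = "('o, 'm) ab_obj" +
  act :: 'm

abbreviation Plus ::
  "('o, 'm, 'x) ab_obj_scheme \<Rightarrow> ('o, 'm) tm \<Rightarrow> ('o, 'm) tm \<Rightarrow> ('o, 'm) tm" where
  "Plus G s t \<equiv> Fn (gadd G) (Pair s t)"

abbreviation Times ::
  "('o, 'm, 'x) ring_obj_scheme \<Rightarrow> ('o, 'm) tm \<Rightarrow> ('o, 'm) tm \<Rightarrow> ('o, 'm) tm" where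
  "Times A s t \<equiv> Fn (rmul A) (Pair s t)"

abbreviation Act ::
  "('o, 'm, 'x) mod_obj_scheme \<Rightarrow> ('o, 'm) tm \<Rightarrow> ('o, 'm) tm \<Rightarrow> ('o, 'm) tm" where
  "Act M s t \<equiv> Fn (act M) (Pair s t)"

context topos
begin

definition ab_group_object :: "('o, 'm, 'x) ab_obj_scheme \<Rightarrow> bool" where
  "ab_group_object G \<longleftrightarrow>
     car G \<in> Ob E \<and> gadd G \<in> Hm E (car G \<^bold>\<times> car G) (car G) \<and>
     gzero G \<in> Hm E (One E) (car G) \<and> gneg G \<in> Hm E (car G) (car G) \<and>
     valid (All (car G) (All (car G) (All (car G)
       (Eq (Plus G (Plus G (Var 2) (Var 1)) (Var 0)) (Plus G (Var 2) (Plus G (Var 1) (Var 0))))))) \<and>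
     valid (All (car G) (All (car G) (Eq (Plus G (Var 1) (Var 0)) (Plus G (Var 0) (Var 1))))) \<and>
     valid (All (car G) (Eq (Plus G (Fn (gzero G) Unit) (Var 0)) (Var 0))) \<and>
     valid (All (car G) (Eq (Plus G (Fn (gneg G) (Var 0)) (Var 0)) (Fn (gzero G) Unit)))"

definition ring_object :: "('o, 'm, 'x) ring_obj_scheme \<Rightarrow> bool" where
  "ring_object A \<longleftrightarrow>
     ab_group_object A \<and>
     rmul A \<in> Hm E (car A \<^bold>\<times> car A) (car A) \<and> runit A \<in> Hm E (One E) (car A) \<and>
     valid (All (car A) (All (car A) (All (car A)
       (Eq (Times A (Times A (Var 2) (Var 1)) (Var 0))
           (Times A (Var 2) (Times A (Var 1) (Var 0))))))) \<and>
     valid (All (car A) (Eq (Times A (Fn (runit A) Unit) (Var 0)) (Var 0))) \<and>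
     valid (All (car A) (Eq (Times A (Var 0) (Fn (runit A) Unit)) (Var 0))) \<and>
     valid (All (car A) (All (car A) (All (car A)
       (Eq (Times A (Plus A (Var 2) (Var 1)) (Var 0))
           (Plus A (Times A (Var 2) (Var 0)) (Times A (Var 1) (Var 0))))))) \<and>
     valid (All (car A) (All (car A) (All (car A)
       (Eq (Times A (Var 2) (Plus A (Var 1) (Var 0)))
           (Plus A (Times A (Var 2) (Var 1)) (Times A (Var 2) (Var 0)))))))"

definition right_module :: "('o, 'm) ring_obj \<Rightarrow> ('o, 'm) mod_obj \<Rightarrow> bool" where
  "right_module A M \<longleftrightarrow>
     ab_group_object M \<and> act M \<in> Hm E (car M \<^bold>\<times> car A) (car M) \<and>
     valid (All (car M) (All (car M) (All (car A)
       (Eq (Act M (Plus M (Var 2) (Var 1)) (Var 0))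
           (Plus M (Act M (Var 2) (Var 0)) (Act M (Var 1) (Var 0))))))) \<and>
     valid (All (car M) (All (car A) (All (car A)
       (Eq (Act M (Var 2) (Plus A (Var 1) (Var 0)))
           (Plus M (Act M (Var 2) (Var 1)) (Act M (Var 2) (Var 0))))))) \<and>
     valid (All (car M) (All (car A) (All (car A)
       (Eq (Act M (Var 2) (Times A (Var 1) (Var 0))) (Act M (Act M (Var 2) (Var 1)) (Var 0)))))) \<and>
     valid (All (car M) (Eq (Act M (Var 0) (Fn (runit A) Unit)) (Var 0)))"

definition left_module :: "('o, 'm) ring_obj \<Rightarrow> ('o, 'm) mod_obj \<Rightarrow> bool" where
  "left_module A N \<longleftrightarrow>
     ab_group_object N \<and> act N \<in> Hm E (car A \<^bold>\<times> car N) (car N) \<and>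
     valid (All (car A) (All (car N) (All (car N)
       (Eq (Act N (Var 2) (Plus N (Var 1) (Var 0)))
           (Plus N (Act N (Var 2) (Var 1)) (Act N (Var 2) (Var 0))))))) \<and>
     valid (All (car A) (All (car A) (All (car N)
       (Eq (Act N (Plus A (Var 2) (Var 1)) (Var 0))
           (Plus N (Act N (Var 2) (Var 0)) (Act N (Var 1) (Var 0))))))) \<and>
     valid (All (car A) (All (car A) (All (car N)
       (Eq (Act N (Times A (Var 2) (Var 1)) (Var 0)) (Act N (Var 2) (Act N (Var 1) (Var 0))))))) \<and>
     valid (All (car N) (Eq (Act N (Fn (runit A) Unit) (Var 0)) (Var 0)))"

definition group_hom ::
  "('o, 'm, 'x) ab_obj_scheme \<Rightarrow> ('o, 'm, 'y) ab_obj_scheme \<Rightarrow> 'm set" where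
  "group_hom G H = {h \<in> Hm E (car G) (car H). h \<cdot> gadd G = gadd H \<cdot> prod_map h h}"

definition right_module_hom ::
  "('o, 'm) ring_obj \<Rightarrow> ('o, 'm) mod_obj \<Rightarrow> ('o, 'm) mod_obj \<Rightarrow> 'm set" where
  "right_module_hom A M M' =
     {h \<in> group_hom M M'. h \<cdot> act M = act M' \<cdot> prod_map h (Id E (car A))}"

text \<open>The groups \<open>Hom\<^sub>Z(G,H)\<close> and \<open>Hom\<^sub>A(M,M')\<close>, under addition of morphisms.\<close>

definition Hom_Z ::
  "('o, 'm, 'x) ab_obj_scheme \<Rightarrow> ('o, 'm, 'y) ab_obj_scheme \<Rightarrow> 'm monoid" where
  "Hom_Z G H = \<lparr>carrier = group_hom G H, mult = (\<lambda>u v. gadd H \<cdot> \<langle>u, v\<rangle>),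
                one = gzero H \<cdot> bang (car G)\<rparr>"

definition Hom_A ::
  "('o, 'm) ring_obj \<Rightarrow> ('o, 'm) mod_obj \<Rightarrow> ('o, 'm) mod_obj \<Rightarrow> 'm monoid" where
  "Hom_A A M M' = \<lparr>carrier = right_module_hom A M M', mult = (\<lambda>u v. gadd M' \<cdot> \<langle>u, v\<rangle>),
                   one = gzero M' \<cdot> bang (car M)\<rparr>"

text \<open>
  \<open>hom_incl N P\<close> is the inclusion into \<open>[N,P]\<close> of
  $[N,P]_{\mathbf Z} = \{f \mid \forall n,n'{:}N\,(f(n+n') = f(n)+f(n'))\}$.
  All structure on \<open>[N,P]\<^sub>Z\<close> is the restriction (\<open>hom_lift\<close>) of the pointwise structure on
  \<open>[N,P]\<close>, which is given by transposition.
\<close>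

definition hom_incl ::
  "('o, 'm, 'x) ab_obj_scheme \<Rightarrow> ('o, 'm, 'y) ab_obj_scheme \<Rightarrow> 'm" where
  "hom_incl N P = compr (Exp E (car N) (car P))
     (All (car N) (All (car N)
       (Eq (App (car N) (car P) (Var 2) (Plus N (Var 1) (Var 0)))
           (Plus P (App (car N) (car P) (Var 2) (Var 1)) (App (car N) (car P) (Var 2) (Var 0))))))"

definition hom_car ::
  "('o, 'm, 'x) ab_obj_scheme \<Rightarrow> ('o, 'm, 'y) ab_obj_scheme \<Rightarrow> 'o" where
  "hom_car N P = Dom E (hom_incl N P)"

definition hom_lift ::
  "('o, 'm, 'x) ab_obj_scheme \<Rightarrow> ('o, 'm, 'y) ab_obj_scheme \<Rightarrow> 'm \<Rightarrow> 'm" where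
  "hom_lift N P s = (THE r. r \<in> Hm E (Dom E s) (hom_car N P) \<and> hom_incl N P \<cdot> r = s)"

text \<open>
  \<open>hom_abs N P X t\<close> is the generalized element \<open>\<lambda>n. t(x,n)\<close> of \<open>[N,P]\<^sub>Z\<close> at stage \<open>X\<close>, and
  \<open>hom_app N P f n\<close> is the value of a generalized element \<open>f\<close> of \<open>[N,P]\<^sub>Z\<close> at \<open>n\<close>.
\<close>

definition hom_abs ::
  "('o, 'm, 'x) ab_obj_scheme \<Rightarrow> ('o, 'm, 'y) ab_obj_scheme \<Rightarrow> 'o \<Rightarrow> 'm \<Rightarrow> 'm" where
  "hom_abs N P X t = hom_lift N P (curry X (car N) (car P) t)"

definition hom_app ::
  "('o, 'm, 'x) ab_obj_scheme \<Rightarrow> ('o, 'm, 'y) ab_obj_scheme \<Rightarrow> 'm \<Rightarrow> 'm \<Rightarrow> 'm" where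
  "hom_app N P f n = Ev E (car N) (car P) \<cdot> \<langle>hom_incl N P \<cdot> f, n\<rangle>"

definition hom_obj ::
  "('o, 'm) ring_obj \<Rightarrow> ('o, 'm) mod_obj \<Rightarrow> ('o, 'm, 'y) ab_obj_scheme \<Rightarrow> ('o, 'm) mod_obj" where
  "hom_obj A N P = (let H = hom_car N P; n = car N; a = car A in
     \<lparr>car = H,
      gadd = hom_abs N P (H \<^bold>\<times> H)
        (gadd P \<cdot> \<langle>hom_app N P (Fst E H H \<cdot> Fst E (H \<^bold>\<times> H) n) (Snd E (H \<^bold>\<times> H) n),
                  hom_app N P (Snd E H H \<cdot> Fst E (H \<^bold>\<times> H) n) (Snd E (H \<^bold>\<times> H) n)\<rangle>),
      gzero = hom_abs N P (One E) (gzero P \<cdot> bang (One E \<^bold>\<times> n)),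
      gneg = hom_abs N P H (gneg P \<cdot> hom_app N P (Fst E H n) (Snd E H n)),
      act = hom_abs N P (H \<^bold>\<times> a)
        (hom_app N P (Fst E H a \<cdot> Fst E (H \<^bold>\<times> a) n)
          (act N \<cdot> \<langle>Snd E H a \<cdot> Fst E (H \<^bold>\<times> a) n, Snd E (H \<^bold>\<times> a) n\<rangle>))\<rparr>)"

text \<open>\<open>hom_map N P Q g\<close> is \<open>[N,g]\<^sub>Z : [N,P]\<^sub>Z \<rightarrow> [N,Q]\<^sub>Z\<close>, for a homomorphism \<open>g : P \<rightarrow> Q\<close>.\<close>

definition hom_map ::
  "('o, 'm, 'x) ab_obj_scheme \<Rightarrow> ('o, 'm, 'y) ab_obj_scheme \<Rightarrow> ('o, 'm, 'z) ab_obj_scheme \<Rightarrow>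
    'm \<Rightarrow> 'm" where
  "hom_map N P Q g = (let H = hom_car N P in
     hom_abs N Q H (g \<cdot> hom_app N P (Fst E H (car N)) (Snd E H (car N))))"

text \<open>
  \<open>(T, \<Phi>)\<close> represents the functor $P \mapsto \mathrm{Hom}_A(M,[N,P]_{\mathbf Z})$ from abelian
  group objects to abelian groups, that is, \<open>T\<close> is a tensor product of \<open>M\<close> and \<open>N\<close> over \<open>A\<close>.
\<close>

definition represents ::
  "('o, 'm) ring_obj \<Rightarrow> ('o, 'm) mod_obj \<Rightarrow> ('o, 'm) mod_obj \<Rightarrow>
    ('o, 'm) ab_obj \<Rightarrow> (('o, 'm) ab_obj \<Rightarrow> 'm \<Rightarrow> 'm) \<Rightarrow> bool" where
  "represents A M N T \<Phi> \<longleftrightarrow>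
     ab_group_object T \<and>
     (\<forall>P. ab_group_object P \<longrightarrow> \<Phi> P \<in> iso (Hom_Z T P) (Hom_A A M (hom_obj A N P))) \<and>
     (\<forall>P Q g h. ab_group_object P \<longrightarrow> ab_group_object Q \<longrightarrow>
        g \<in> group_hom P Q \<longrightarrow> h \<in> group_hom T P \<longrightarrow>
        \<Phi> Q (g \<cdot> h) = hom_map N P Q g \<cdot> \<Phi> P h)"

definition tensor_unit ::
  "('o, 'm) ab_obj \<Rightarrow> (('o, 'm) ab_obj \<Rightarrow> 'm \<Rightarrow> 'm) \<Rightarrow> 'm" where
  "tensor_unit T \<Phi> = \<Phi> T (Id E (car T))"

text \<open>The transpose \<open>M \<times> N \<rightarrow> T\<close> of the unit followed by the inclusion into \<open>[N,T]\<close>.\<close>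

definition tensor_map ::
  "('o, 'm) mod_obj \<Rightarrow> ('o, 'm) ab_obj \<Rightarrow> (('o, 'm) ab_obj \<Rightarrow> 'm \<Rightarrow> 'm) \<Rightarrow> 'm" where
  "tensor_map N T \<Phi> =
     Ev E (car N) (car T) \<cdot> prod_map (hom_incl N T \<cdot> tensor_unit T \<Phi>) (Id E (car N))"

definition balanced_product ::
  "('o, 'm) ring_obj \<Rightarrow> ('o, 'm) mod_obj \<Rightarrow> ('o, 'm) mod_obj \<Rightarrow> ('o, 'm) ab_obj \<Rightarrow>
    'm \<Rightarrow> bool" where
  "balanced_product A M N P f \<longleftrightarrow>
     f \<in> Hm E (car M \<^bold>\<times> car N) (car P) \<and>
     valid (All (car M) (All (car M) (All (car N)
       (Eq (Fn f (Pair (Plus M (Var 2) (Var 1)) (Var 0)))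
           (Plus P (Fn f (Pair (Var 2) (Var 0))) (Fn f (Pair (Var 1) (Var 0)))))))) \<and>
     valid (All (car M) (All (car N) (All (car N)
       (Eq (Fn f (Pair (Var 2) (Plus N (Var 1) (Var 0))))
           (Plus P (Fn f (Pair (Var 2) (Var 1))) (Fn f (Pair (Var 2) (Var 0)))))))) \<and>
     valid (All (car M) (All (car A) (All (car N)
       (Eq (Fn f (Pair (Act M (Var 2) (Var 1)) (Var 0)))
           (Fn f (Pair (Var 2) (Act N (Var 1) (Var 0))))))))"

end

end

theory Submission
  imports Defs
begin

text \<open>
  By Kripke--Joyal forcing, the internal axioms become equations between generalized elements, so
  a balanced product \<open>f : M \<times> N \<rightarrow> P\<close> is the same thing as an \<open>A\<close>-linear map
  \<open>M \<rightarrow> [N,P]\<^sub>Z\<close>, its transpose.  Naturality of \<open>\<Phi>\<close> at the identity of \<open>T\<close> gives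
  \<open>\<Phi> P g = [N,g]\<^sub>Z \<cdot> \<eta>\<close>, whose transpose is \<open>g \<cdot> \<otimes>\<close>.  Hence \<open>g \<cdot> \<otimes> = f\<close> says exactly
  that \<open>\<Phi> P g\<close> is the transpose of \<open>f\<close>, and \<open>\<Phi> P\<close> is bijective.
\<close>

text \<open>The operations on \<open>[N,P]_Z\<close> are defined through \<open>THE\<close>, so
  nothing is known about them until the transposed morphism is shown to factor through
  \<open>hom_incl N P\<close>. This shapes the proof. For addition, action and
  \<open>[N,g]_Z\<close> in turn, the body is shown to be additive in \<open>N\<close> at every
  stage; \<open>hom_abs\<close> then turns the definition into a formula for its values, and the
  curried morphisms need not be touched again. Forcing therefore has to work in both directions: the
  axioms are read off as equations, while membership in the comprehension that defines
  \<open>[N,P]_Z\<close> has to be derived from equations. Since the universal quantifier ranges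
  over all stages, additivity is always proved for generalized elements of an arbitrary domain
  \<open>V\<close>. Equality of two morphisms \<open>W\<close> to \<open>[N,P]_Z\<close> is easier:
  it is decided by a single value, at the two projections of \<open>W\<close> times
  \<open>N\<close>.\<close>

context category
begin

section \<open>Rewriting rules for composition, and pullbacks\<close>

lemma Hm_iff: "f \<in> Hm E X Y \<longleftrightarrow> f \<in> Ar E \<and> Dom E f = X \<and> Cod E f = Y"
  by (simp add: Hm_def)

lemma Hm_Ob:
  assumes "f \<in> Hm E X Y"
  shows "X \<in> Ob E" and "Y \<in> Ob E"
  using assms Dom_Ob Cod_Ob by (auto simp: Hm_iff)

text \<open>Rewrite rules have premises about \<open>Ar\<close>, \<open>Dom\<close> and
  \<open>Cod\<close> instead of \<open>Hm\<close>, because the objects in an \<open>Hm\<close>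
  premise would not be determined by the left-hand side. Proofs pass between the two forms by
  \<open>Hm_iff\<close>.\<close>

lemma Comp_simps [simp]:
  assumes "f \<in> Ar E" "g \<in> Ar E" "Cod E f = Dom E g"
  shows "g \<cdot> f \<in> Ar E" and "Dom E (g \<cdot> f) = Dom E f" and "Cod E (g \<cdot> f) = Cod E g"
  using Comp_Hm[of f "Dom E f" "Dom E g" g "Cod E g"] assms by (simp_all add: Hm_iff)

lemma Id_simps [simp]:
  assumes "X \<in> Ob E"
  shows "Id E X \<in> Ar E" and "Dom E (Id E X) = X" and "Cod E (Id E X) = X"
  using Id_Hm[OF assms] by (simp_all add: Hm_iff)

lemma Comp_assoc_simp [simp]:
  assumes "f \<in> Ar E" "g \<in> Ar E" "h \<in> Ar E" "Cod E f = Dom E g" "Cod E g = Dom E h"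
  shows "(h \<cdot> g) \<cdot> f = h \<cdot> (g \<cdot> f)"
  using Comp_assoc[of f "Dom E f" "Dom E g" g "Dom E h" h "Cod E h"] assms by (simp add: Hm_iff)

lemma Comp_Id_simps [simp]:
  assumes "f \<in> Ar E"
  shows "Dom E f = X \<Longrightarrow> f \<cdot> Id E X = f" and "Cod E f = Y \<Longrightarrow> Id E Y \<cdot> f = f"
  using Id_right[of f] Id_left[of f] assms by (simp_all add: Hm_iff)

text \<open>\<open>is_pullback\<close> hides its objects behind existential quantifiers, but the
  four morphisms determine them. This lemma and the next restate it with domains in place of the
  unnamed objects.\<close>

lemma is_pullback_commutes:
  assumes "is_pullback f g p q"
  shows "p \<in> Hm E (Dom E p) (Dom E f)" "q \<in> Hm E (Dom E p) (Dom E g)" "f \<cdot> p = g \<cdot> q"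
  using assms unfolding is_pullback_def by (auto simp: Hm_iff)

lemma is_pullback_universal:
  assumes "is_pullback f g p q" "u \<in> Hm E W (Dom E f)" "v \<in> Hm E W (Dom E g)" "f \<cdot> u = g \<cdot> v"
  shows "\<exists>!h. h \<in> Hm E W (Dom E p) \<and> p \<cdot> h = u \<and> q \<cdot> h = v"
proof -
  obtain Q X Y Z where *: "f \<in> Hm E X Z" "g \<in> Hm E Y Z" "p \<in> Hm E Q X"
    and univ: "\<And>W u v. u \<in> Hm E W X \<Longrightarrow> v \<in> Hm E W Y \<Longrightarrow> f \<cdot> u = g \<cdot> v \<Longrightarrow>
       \<exists>!h. h \<in> Hm E W Q \<and> p \<cdot> h = u \<and> q \<cdot> h = v"
    using assms(1) unfolding is_pullback_def by blast
  have eqs: "Dom E f = X" "Dom E g = Y" "Dom E p = Q"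
    using * by (simp_all add: Hm_iff)
  show ?thesis
    using univ[OF assms(2-4)[unfolded eqs]] unfolding eqs .
qed

end

section \<open>Terminal object, products and two kinds of monomorphism\<close>

context finitely_complete_category
begin

lemma One_Ob [simp]: "One E \<in> Ob E"
  using One_terminal by (simp add: is_terminal_def)

lemma bang_Hm: "X \<in> Ob E \<Longrightarrow> bang X \<in> Hm E X (One E)"
  unfolding bang_def using One_terminal
  by (intro theI'[where P = "\<lambda>t. t \<in> Hm E X (One E)"]) (simp add: is_terminal_def)

lemma bang_simps [simp]:
  assumes "X \<in> Ob E"
  shows "bang X \<in> Ar E" and "Dom E (bang X) = X" and "Cod E (bang X) = One E"
  using bang_Hm[OF assms] by (simp_all add: Hm_iff)

lemma bang_unique:
  assumes "t \<in> Hm E X (One E)"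
  shows "t = bang X"
proof -
  have "X \<in> Ob E" using assms by (rule Hm_Ob)
  then show ?thesis
    using One_terminal bang_Hm[of X] assms by (auto simp: is_terminal_def)
qed

lemma bang_Comp [simp]:
  assumes "h \<in> Ar E" "Cod E h = X"
  shows "bang X \<cdot> h = bang (Dom E h)"
proof -
  have "X \<in> Ob E" using assms Cod_Ob by blast
  then show ?thesis using assms by (intro bang_unique) (simp add: Hm_iff)
qed

lemma projection_simps [simp]:
  assumes "X \<in> Ob E" "Y \<in> Ob E"
  shows "Fst E X Y \<in> Ar E" and "Dom E (Fst E X Y) = X \<^bold>\<times> Y" and "Cod E (Fst E X Y) = X"
    and "Snd E X Y \<in> Ar E" and "Dom E (Snd E X Y) = X \<^bold>\<times> Y" and "Cod E (Snd E X Y) = Y"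
  using Prod_product[OF assms] by (simp_all add: is_product_def Hm_iff)

lemma Prod_Ob [simp]: "X \<in> Ob E \<Longrightarrow> Y \<in> Ob E \<Longrightarrow> X \<^bold>\<times> Y \<in> Ob E"
  using Dom_Ob[of "Fst E X Y"] by simp

lemma pair_spec:
  assumes "f \<in> Hm E Z X" "g \<in> Hm E Z Y"
  shows "\<langle>f, g\<rangle> \<in> Hm E Z (X \<^bold>\<times> Y) \<and> Fst E X Y \<cdot> \<langle>f, g\<rangle> = f \<and> Snd E X Y \<cdot> \<langle>f, g\<rangle> = g"
proof -
  have "\<exists>!h. h \<in> Hm E Z (X \<^bold>\<times> Y) \<and> Fst E X Y \<cdot> h = f \<and> Snd E X Y \<cdot> h = g"
    using Prod_product[of X Y] Hm_Ob assms by (auto simp: is_product_def)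
  from theI'[OF this] show ?thesis
    using assms unfolding pair_def by (simp add: Hm_iff)
qed

lemma pair_simps [simp]:
  assumes "f \<in> Ar E" "g \<in> Ar E" "Dom E f = Dom E g"
  shows "\<langle>f, g\<rangle> \<in> Ar E" and "Dom E \<langle>f, g\<rangle> = Dom E g" and "Cod E \<langle>f, g\<rangle> = Cod E f \<^bold>\<times> Cod E g"
    and "Cod E f = X \<Longrightarrow> Cod E g = Y \<Longrightarrow> Fst E X Y \<cdot> \<langle>f, g\<rangle> = f"
    and "Cod E f = X \<Longrightarrow> Cod E g = Y \<Longrightarrow> Snd E X Y \<cdot> \<langle>f, g\<rangle> = g"
  using pair_spec[of f "Dom E g" "Cod E f" g "Cod E g"] assms by (auto simp: Hm_iff)

lemma prod_ext:
  assumes "h \<in> Hm E Z (X \<^bold>\<times> Y)" "k \<in> Hm E Z (X \<^bold>\<times> Y)" "X \<in> Ob E" "Y \<in> Ob E"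
    and "Fst E X Y \<cdot> h = Fst E X Y \<cdot> k" "Snd E X Y \<cdot> h = Snd E X Y \<cdot> k"
  shows "h = k"
proof -
  have "Fst E X Y \<cdot> k \<in> Hm E Z X" "Snd E X Y \<cdot> k \<in> Hm E Z Y"
    using assms by (simp_all add: Hm_iff)
  then have "\<exists>!l. l \<in> Hm E Z (X \<^bold>\<times> Y) \<and> Fst E X Y \<cdot> l = Fst E X Y \<cdot> k \<and> Snd E X Y \<cdot> l = Snd E X Y \<cdot> k"
    using Prod_product[of X Y] assms by (auto simp: is_product_def)
  then show ?thesis using assms by blast
qed

text \<open>With composites bracketed to the right, this rule pushes substitution into pairs. The
  interpretation of a term, precomposed with a tuple of generalized elements, thereby simplifies to
  the expected expression in these elements.\<close>

lemma pair_Comp [simp]: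
  assumes "f \<in> Ar E" "g \<in> Ar E" "Dom E f = Dom E g" "h \<in> Ar E" "Cod E h = Dom E g"
  shows "\<langle>f, g\<rangle> \<cdot> h = \<langle>f \<cdot> h, g \<cdot> h\<rangle>"
proof (rule prod_ext[of _ "Dom E h" "Cod E f" "Cod E g"])
  \<comment> \<open>Bracketing to the left, against the orientation of the simplifier, brings each
    projection next to the pair that it cancels.\<close>
  have *: "Fst E (Cod E f) (Cod E g) \<cdot> (\<langle>f, g\<rangle> \<cdot> h) = (Fst E (Cod E f) (Cod E g) \<cdot> \<langle>f, g\<rangle>) \<cdot> h"
    "Snd E (Cod E f) (Cod E g) \<cdot> (\<langle>f, g\<rangle> \<cdot> h) = (Snd E (Cod E f) (Cod E g) \<cdot> \<langle>f, g\<rangle>) \<cdot> h"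
    using assms Cod_Ob by (intro Comp_assoc_simp[symmetric]; simp)+
  show "Fst E (Cod E f) (Cod E g) \<cdot> (\<langle>f, g\<rangle> \<cdot> h) = Fst E (Cod E f) (Cod E g) \<cdot> \<langle>f \<cdot> h, g \<cdot> h\<rangle>"
    "Snd E (Cod E f) (Cod E g) \<cdot> (\<langle>f, g\<rangle> \<cdot> h) = Snd E (Cod E f) (Cod E g) \<cdot> \<langle>f \<cdot> h, g \<cdot> h\<rangle>"
    unfolding * using assms by simp_all
qed (use assms Cod_Ob in \<open>simp_all add: Hm_iff\<close>)

lemma pair_projections [simp]:
  "X \<in> Ob E \<Longrightarrow> Y \<in> Ob E \<Longrightarrow> \<langle>Fst E X Y, Snd E X Y\<rangle> = Id E (X \<^bold>\<times> Y)"
  by (rule prod_ext[of _ "X \<^bold>\<times> Y" X Y]) (simp_all add: Hm_iff)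

lemma mono_from_One:
  assumes "m \<in> Hm E (One E) X"
  shows "is_mono m"
proof -
  have "m \<in> Ar E" "Dom E m = One E" using assms by (simp_all add: Hm_iff)
  then show ?thesis unfolding is_mono_def using bang_unique by metis
qed

text \<open>The first projection is a retraction of the diagonal.\<close>

lemma mono_diagonal: "X \<in> Ob E \<Longrightarrow> is_mono \<langle>Id E X, Id E X\<rangle>"
  unfolding is_mono_def
proof (intro conjI allI impI)
  fix W u v
  assume *: "X \<in> Ob E" "u \<in> Hm E W (Dom E \<langle>Id E X, Id E X\<rangle>)" "v \<in> Hm E W (Dom E \<langle>Id E X, Id E X\<rangle>)"
    "\<langle>Id E X, Id E X\<rangle> \<cdot> u = \<langle>Id E X, Id E X\<rangle> \<cdot> v"
  have "Fst E X X \<cdot> (\<langle>Id E X, Id E X\<rangle> \<cdot> u) = u" "Fst E X X \<cdot> (\<langle>Id E X, Id E X\<rangle> \<cdot> v) = v"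
    using *(1-3) by (simp_all add: Hm_iff)
  then show "u = v" unfolding *(4) by simp
qed simp

end

section \<open>Exponentials, and the meaning of the equality and quantifier predicates\<close>

context topos
begin

lemma Omega_Ob [simp]: "\<Omega> \<in> Ob E"
  using Truth_Hm by (rule Hm_Ob)

lemma Truth_simps [simp]: "\<top> \<in> Ar E" "Dom E \<top> = One E" "Cod E \<top> = \<Omega>"
  using Truth_Hm by (simp_all add: Hm_iff)

lemma Ev_simps [simp]:
  assumes "N \<in> Ob E" "P \<in> Ob E"
  shows "Exp E N P \<in> Ob E" and "Ev E N P \<in> Ar E" and "Dom E (Ev E N P) = Exp E N P \<^bold>\<times> N"
    and "Cod E (Ev E N P) = P"
  using Ev_Hm[OF assms] Exp_Ob[OF assms] by (simp_all add: Hm_iff)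

lemma curry_spec:
  assumes "X \<in> Ob E" "N \<in> Ob E" "f \<in> Hm E (X \<^bold>\<times> N) P"
  shows "curry X N P f \<in> Hm E X (Exp E N P) \<and> Ev E N P \<cdot> prod_map (curry X N P f) (Id E N) = f"
  unfolding curry_def by (rule theI'[OF Exp_universal[OF assms]])

lemma curry_simps [simp]:
  assumes "X \<in> Ob E" "N \<in> Ob E" "f \<in> Ar E" "Dom E f = X \<^bold>\<times> N" "Cod E f = P"
  shows "curry X N P f \<in> Ar E" and "Dom E (curry X N P f) = X"
    and "Cod E (curry X N P f) = Exp E N P"
  using curry_spec[of X N f P] assms by (simp_all add: Hm_iff)

text \<open>The beta rule at an arbitrary stage. The universal property supplies it in the form with
  \<open>prod_map\<close>; precomposing with \<open>\<langle>a, n\<rangle>\<close> gives the form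
  that the rewriting of pairs produces.\<close>

lemma Ev_curry [simp]:
  assumes "X \<in> Ob E" "N \<in> Ob E" "f \<in> Ar E" "Dom E f = X \<^bold>\<times> N" "Cod E f = P"
    and "a \<in> Ar E" "n \<in> Ar E" "Dom E a = Dom E n" "Cod E a = X" "Cod E n = N"
  shows "Ev E N P \<cdot> \<langle>curry X N P f \<cdot> a, n\<rangle> = f \<cdot> \<langle>a, n\<rangle>"
proof -
  have P: "P \<in> Ob E" using assms Cod_Ob by blast
  have "f \<cdot> \<langle>a, n\<rangle> = (Ev E N P \<cdot> prod_map (curry X N P f) (Id E N)) \<cdot> \<langle>a, n\<rangle>"
    using curry_spec[of X N f P] assms by (simp add: Hm_iff)
  then show ?thesis using assms P by (simp add: prod_map_def)
qed

text \<open>Extensionality: the projections of \<open>W\<close> times \<open>N\<close> form the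
  generic argument, and evaluating there is the same as uncurrying, which is injective.\<close>

lemma Exp_ext:
  assumes "s \<in> Hm E W (Exp E N P)" "t \<in> Hm E W (Exp E N P)" "N \<in> Ob E" "P \<in> Ob E"
    and "Ev E N P \<cdot> \<langle>s \<cdot> Fst E W N, Snd E W N\<rangle> = Ev E N P \<cdot> \<langle>t \<cdot> Fst E W N, Snd E W N\<rangle>"
  shows "s = t"
proof -
  have W: "W \<in> Ob E" using assms(1) by (rule Hm_Ob)
  have "prod_map s (Id E N) = \<langle>s \<cdot> Fst E W N, Snd E W N\<rangle>"
    and t: "prod_map t (Id E N) = \<langle>t \<cdot> Fst E W N, Snd E W N\<rangle>"
    using assms(1-4) W by (simp_all add: prod_map_def Hm_iff)
  then have eq: "Ev E N P \<cdot> prod_map s (Id E N) = Ev E N P \<cdot> prod_map t (Id E N)"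
    using assms(5) by simp
  have "Ev E N P \<cdot> prod_map t (Id E N) \<in> Hm E (W \<^bold>\<times> N) P"
    unfolding t using assms(1-4) W by (simp add: Hm_iff)
  from Exp_universal[OF W assms(3) this] show ?thesis
    using assms(1,2) eq by blast
qed

lemma char_map_pullback:
  assumes "is_mono m"
  shows "char_map m \<in> Hm E (Cod E m) \<Omega>" "is_pullback (char_map m) \<top> m (bang (Dom E m))"
  using theI'[OF Omega_classifies[OF assms]] unfolding char_map_def by auto

text \<open>Truth of a predicate at \<open>x\<close> means that \<open>x\<close> factors through the
  subobject it classifies: \<open>bang W\<close> serves as the second leg in one direction, and in
  the other the second leg is forced to be \<open>bang W\<close>. The equality predicate, the
  quantifier and the comprehension behind \<open>hom_incl\<close> all get their meaning from this
  equivalence.\<close>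

lemma pullback_Truth_iff:
  assumes "is_pullback \<chi> \<top> m q" "x \<in> Hm E W (Dom E \<chi>)"
  shows "\<chi> \<cdot> x = \<top> \<cdot> bang W \<longleftrightarrow> (\<exists>r. r \<in> Hm E W (Dom E m) \<and> m \<cdot> r = x)"
proof
  have W: "W \<in> Ob E" using assms(2) by (rule Hm_Ob)
  assume "\<chi> \<cdot> x = \<top> \<cdot> bang W"
  then show "\<exists>r. r \<in> Hm E W (Dom E m) \<and> m \<cdot> r = x"
    using is_pullback_universal[OF assms(1,2), of "bang W"] W by (auto simp: Hm_iff)
next
  assume "\<exists>r. r \<in> Hm E W (Dom E m) \<and> m \<cdot> r = x"
  then obtain r where r: "r \<in> Hm E W (Dom E m)" "m \<cdot> r = x" by blast
  note p = is_pullback_commutes[OF assms(1)]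
  have "\<chi> \<in> Ar E" using assms(1) by (auto simp: is_pullback_def Hm_iff)
  then have "\<chi> \<cdot> x = (\<chi> \<cdot> m) \<cdot> r" using r p(1,2) by (auto simp: Hm_iff)
  also have "\<dots> = (\<top> \<cdot> q) \<cdot> r" by (simp only: p(3))
  also have "\<dots> = \<top> \<cdot> (q \<cdot> r)" using r(1) p(1,2) by (simp add: Hm_iff)
  also have "q \<cdot> r = bang W" using r p by (intro bang_unique) (simp add: Hm_iff)
  finally show "\<chi> \<cdot> x = \<top> \<cdot> bang W" .
qed

lemma eq_pred_simps [simp]:
  assumes "X \<in> Ob E"
  shows "eq_pred X \<in> Ar E" "Dom E (eq_pred X) = X \<^bold>\<times> X" "Cod E (eq_pred X) = \<Omega>"
  using char_map_pullback(1)[OF mono_diagonal[OF assms]] assms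
  by (simp_all add: Hm_iff eq_pred_def)

lemma eq_pred_iff:
  assumes "s \<in> Hm E W X" "t \<in> Hm E W X"
  shows "eq_pred X \<cdot> \<langle>s, t\<rangle> = \<top> \<cdot> bang W \<longleftrightarrow> s = t"
proof -
  have ob: "X \<in> Ob E" "W \<in> Ob E" using Hm_Ob assms by blast+
  have "eq_pred X \<cdot> \<langle>s, t\<rangle> = \<top> \<cdot> bang W \<longleftrightarrow>
      (\<exists>r. r \<in> Hm E W (Dom E \<langle>Id E X, Id E X\<rangle>) \<and> \<langle>Id E X, Id E X\<rangle> \<cdot> r = \<langle>s, t\<rangle>)"
    unfolding eq_pred_def
    using char_map_pullback[OF mono_diagonal[OF ob(1)]] assms ob
    by (intro pullback_Truth_iff) (auto simp: Hm_iff)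
  also have "\<dots> \<longleftrightarrow> (\<exists>r. r \<in> Hm E W X \<and> \<langle>r, r\<rangle> = \<langle>s, t\<rangle>)"
    using ob by (auto simp: Hm_iff)
  also have "\<dots> \<longleftrightarrow> s = t"
  proof
    assume "\<exists>r. r \<in> Hm E W X \<and> \<langle>r, r\<rangle> = \<langle>s, t\<rangle>"
    then obtain r where r: "r \<in> Hm E W X" "\<langle>r, r\<rangle> = \<langle>s, t\<rangle>" by blast
    then have "Fst E X X \<cdot> \<langle>r, r\<rangle> = Fst E X X \<cdot> \<langle>s, t\<rangle>" "Snd E X X \<cdot> \<langle>r, r\<rangle> = Snd E X X \<cdot> \<langle>s, t\<rangle>"
      by simp_all
    then show "s = t" using r(1) assms ob by (simp add: Hm_iff)
  qed (use assms in auto)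
  finally show ?thesis .
qed

lemma true_name_mono: "X \<in> Ob E \<Longrightarrow> is_mono (curry (One E) X \<Omega> (\<top> \<cdot> bang (One E \<^bold>\<times> X)))"
  by (rule mono_from_One[of _ "Exp E X \<Omega>"]) (simp add: Hm_iff)

lemma all_pred_simps [simp]:
  assumes "X \<in> Ob E"
  shows "all_pred X \<in> Ar E" "Dom E (all_pred X) = Exp E X \<Omega>" "Cod E (all_pred X) = \<Omega>"
  using char_map_pullback(1)[OF true_name_mono[OF assms]] assms
  by (simp_all add: Hm_iff all_pred_def)

lemma all_pred_iff:
  assumes "X \<in> Ob E" "s \<in> Hm E W (Exp E X \<Omega>)"
  shows "all_pred X \<cdot> s = \<top> \<cdot> bang W \<longleftrightarrow>
    Ev E X \<Omega> \<cdot> \<langle>s \<cdot> Fst E W X, Snd E W X\<rangle> = \<top> \<cdot> bang (W \<^bold>\<times> X)"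
proof -
  let ?n = "curry (One E) X \<Omega> (\<top> \<cdot> bang (One E \<^bold>\<times> X))"
  have W: "W \<in> Ob E" using assms(2) by (rule Hm_Ob)
  have "all_pred X \<cdot> s = \<top> \<cdot> bang W \<longleftrightarrow> (\<exists>r. r \<in> Hm E W (Dom E ?n) \<and> ?n \<cdot> r = s)"
    unfolding all_pred_def
    using char_map_pullback[OF true_name_mono[OF assms(1)]] assms W
    by (intro pullback_Truth_iff) (auto simp: Hm_iff)
  \<comment> \<open>The name \<open>?n\<close> has domain 1, so the only candidate for the factor is
    \<open>bang W\<close>. What remains is to compare \<open>s\<close> with the constantly true
    predicate, which \<open>Exp_ext\<close> does.\<close>
  also have "\<dots> \<longleftrightarrow> ?n \<cdot> bang W = s"
  proof -
    have "Dom E ?n = One E" using assms(1) by simp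
    then show ?thesis using bang_Hm[OF W] bang_unique by metis
  qed
  also have "\<dots> \<longleftrightarrow> Ev E X \<Omega> \<cdot> \<langle>s \<cdot> Fst E W X, Snd E W X\<rangle> = \<top> \<cdot> bang (W \<^bold>\<times> X)" (is "_ \<longleftrightarrow> ?R")
  proof -
    have *: "Ev E X \<Omega> \<cdot> \<langle>(?n \<cdot> bang W) \<cdot> Fst E W X, Snd E W X\<rangle> = \<top> \<cdot> bang (W \<^bold>\<times> X)"
      using W assms(1) by simp
    have "s = ?n \<cdot> bang W" if ?R
    proof (rule Exp_ext[OF assms(2) _ assms(1) Omega_Ob])
      show "?n \<cdot> bang W \<in> Hm E W (Exp E X \<Omega>)" using W assms(1) by (simp add: Hm_iff)
    qed (simp only: that *)
    then show ?thesis using * by auto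
  qed
  finally show ?thesis .
qed

section \<open>Forcing clauses and the equations that follow from validity\<close>

text \<open>Kripke--Joyal forcing at the generalized element \<open>h\<close> of the context \<open>\<Gamma>\<close>.\<close>

definition forces :: "'o list \<Rightarrow> 'm \<Rightarrow> ('o, 'm) fm \<Rightarrow> bool" where
  "forces \<Gamma> h \<phi> \<longleftrightarrow> fm_sem \<Gamma> \<phi> \<cdot> h = \<top> \<cdot> bang (Dom E h)"

lemma ctx_Ob [simp]: "set \<Gamma> \<subseteq> Ob E \<Longrightarrow> ctx \<Gamma> \<in> Ob E"
  by (induction \<Gamma>) auto

lemma fm_sem_Eq_Hm:
  assumes "tm_sem \<Gamma> s \<in> Hm E (ctx \<Gamma>) X" "tm_sem \<Gamma> t \<in> Hm E (ctx \<Gamma>) X"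
  shows "fm_sem \<Gamma> (Eq s t) \<in> Hm E (ctx \<Gamma>) \<Omega>"
  using assms Hm_Ob[OF assms(1)] by (simp add: Hm_iff)

lemma fm_sem_All_Hm:
  assumes "set (X # \<Gamma>) \<subseteq> Ob E" "fm_sem (X # \<Gamma>) \<phi> \<in> Hm E (ctx (X # \<Gamma>)) \<Omega>"
  shows "fm_sem \<Gamma> (All X \<phi>) \<in> Hm E (ctx \<Gamma>) \<Omega>"
  using assms by (simp add: Hm_iff)

lemma forces_Eq_iff:
  assumes "tm_sem \<Gamma> s \<in> Hm E (ctx \<Gamma>) X" "tm_sem \<Gamma> t \<in> Hm E (ctx \<Gamma>) X" "h \<in> Hm E W (ctx \<Gamma>)"
  shows "forces \<Gamma> h (Eq s t) \<longleftrightarrow> tm_sem \<Gamma> s \<cdot> h = tm_sem \<Gamma> t \<cdot> h"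
  using eq_pred_iff[of "tm_sem \<Gamma> s \<cdot> h" W X "tm_sem \<Gamma> t \<cdot> h"] assms Hm_Ob[OF assms(1)]
  by (simp add: forces_def Hm_iff)

text \<open>By \<open>all_pred_iff\<close> the left side is truth over \<open>W\<close> times
  \<open>X\<close> at the projections. Precomposing with \<open>\<langle>k, x\<rangle>\<close>
  carries this to every stage, and the projections themselves are the instance that gives the
  converse.\<close>

lemma forces_All_iff:
  assumes "set (X # \<Gamma>) \<subseteq> Ob E" "fm_sem (X # \<Gamma>) \<phi> \<in> Hm E (ctx (X # \<Gamma>)) \<Omega>"
    and "h \<in> Hm E W (ctx \<Gamma>)"
  shows "forces \<Gamma> h (All X \<phi>) \<longleftrightarrow>
    (\<forall>V k x. k \<in> Hm E V W \<longrightarrow> x \<in> Hm E V X \<longrightarrow> forces (X # \<Gamma>) \<langle>h \<cdot> k, x\<rangle> \<phi>)"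
proof -
  let ?\<phi> = "fm_sem (X # \<Gamma>) \<phi>"
  have ob: "X \<in> Ob E" "W \<in> Ob E" "ctx \<Gamma> \<in> Ob E"
    using assms Hm_Ob[OF assms(3)] by auto
  have "forces \<Gamma> h (All X \<phi>) \<longleftrightarrow>
      all_pred X \<cdot> (curry (ctx \<Gamma>) X \<Omega> ?\<phi> \<cdot> h) = \<top> \<cdot> bang W"
    using assms ob by (simp add: forces_def Hm_iff)
  also have "\<dots> \<longleftrightarrow> ?\<phi> \<cdot> \<langle>h \<cdot> Fst E W X, Snd E W X\<rangle> = \<top> \<cdot> bang (W \<^bold>\<times> X)"
    using assms ob by (subst all_pred_iff) (simp_all add: Hm_iff)
  also have "\<dots> \<longleftrightarrow>
    (\<forall>V k x. k \<in> Hm E V W \<longrightarrow> x \<in> Hm E V X \<longrightarrow> forces (X # \<Gamma>) \<langle>h \<cdot> k, x\<rangle> \<phi>)" (is "?L \<longleftrightarrow> ?R")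
  proof (intro iffI allI impI)
    fix V k x
    assume L: ?L and kx: "k \<in> Hm E V W" "x \<in> Hm E V X"
    have "V \<in> Ob E" using kx(1) by (rule Hm_Ob)
    from L have "(?\<phi> \<cdot> \<langle>h \<cdot> Fst E W X, Snd E W X\<rangle>) \<cdot> \<langle>k, x\<rangle> = (\<top> \<cdot> bang (W \<^bold>\<times> X)) \<cdot> \<langle>k, x\<rangle>"
      by simp
    then show "forces (X # \<Gamma>) \<langle>h \<cdot> k, x\<rangle> \<phi>"
      using assms ob kx by (simp add: forces_def Hm_iff)
  next
    assume ?R
    from this[rule_format, of "Fst E W X" "W \<^bold>\<times> X" "Snd E W X"] show ?L
      using assms ob by (simp add: forces_def Hm_iff)
  qed
  finally show ?thesis .
qed

lemma forces_AllD:
  assumes "forces \<Gamma> h (All X \<phi>)" "set (X # \<Gamma>) \<subseteq> Ob E"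
    and "fm_sem (X # \<Gamma>) \<phi> \<in> Hm E (ctx (X # \<Gamma>)) \<Omega>"
    and "h \<in> Hm E W (ctx \<Gamma>)" "x \<in> Hm E W X"
  shows "forces (X # \<Gamma>) \<langle>h, x\<rangle> \<phi>"
proof -
  have "Id E W \<in> Hm E W W" using assms(5) Hm_Ob Id_Hm by blast
  then have "forces (X # \<Gamma>) \<langle>h \<cdot> Id E W, x\<rangle> \<phi>"
    using forces_All_iff[OF assms(2-4)] assms(1,5) by blast
  then show ?thesis using assms(4) by (simp add: Hm_iff)
qed

lemma valid_forces:
  assumes "valid \<phi>" "W \<in> Ob E"
  shows "forces [] (bang W) \<phi>"
  using assms by (simp add: valid_def forces_def)

text \<open>The environment is nested to the left over \<open>bang W\<close>, as \<open>ctx\<close>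
  is, so \<open>Var 0\<close> reads \<open>y\<close> and \<open>Var 1\<close> reads
  \<open>x\<close>. Terms carry no types; the object \<open>K\<close> in which both sides live has
  to be supplied by each application.\<close>

lemma valid_All2_EqD:
  assumes "valid (All X (All Y (Eq s t)))"
    and "X \<in> Ob E" "Y \<in> Ob E"
    and "tm_sem [Y, X] s \<in> Hm E (ctx [Y, X]) K" "tm_sem [Y, X] t \<in> Hm E (ctx [Y, X]) K"
    and "x \<in> Hm E W X" "y \<in> Hm E W Y"
  shows "tm_sem [Y, X] s \<cdot> \<langle>\<langle>bang W, x\<rangle>, y\<rangle> = tm_sem [Y, X] t \<cdot> \<langle>\<langle>bang W, x\<rangle>, y\<rangle>"
proof -
  have W: "W \<in> Ob E" using assms(6) by (rule Hm_Ob)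
  note t2 = fm_sem_Eq_Hm[OF assms(4,5)]
  have t1: "fm_sem [X] (All Y (Eq s t)) \<in> Hm E (ctx [X]) \<Omega>"
    by (rule fm_sem_All_Hm[OF _ t2]) (use assms(2,3) in simp)
  have h: "bang W \<in> Hm E W (ctx [])" "\<langle>bang W, x\<rangle> \<in> Hm E W (ctx [X])"
      "\<langle>\<langle>bang W, x\<rangle>, y\<rangle> \<in> Hm E W (ctx [Y, X])"
    using assms(6,7) W by (simp_all add: Hm_iff)
  have "forces [X] \<langle>bang W, x\<rangle> (All Y (Eq s t))"
    by (rule forces_AllD[OF valid_forces[OF assms(1) W] _ t1 h(1) assms(6)]) (use assms(2) in simp)
  then have "forces [Y, X] \<langle>\<langle>bang W, x\<rangle>, y\<rangle> (Eq s t)"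
    by (rule forces_AllD[OF _ _ t2 h(2) assms(7)]) (use assms(2,3) in simp)
  then show ?thesis
    using forces_Eq_iff[OF assms(4,5) h(3)] by blast
qed

lemma valid_All3_EqD:
  assumes "valid (All X (All Y (All Z (Eq s t))))"
    and "X \<in> Ob E" "Y \<in> Ob E" "Z \<in> Ob E"
    and "tm_sem [Z, Y, X] s \<in> Hm E (ctx [Z, Y, X]) K" "tm_sem [Z, Y, X] t \<in> Hm E (ctx [Z, Y, X]) K"
    and "x \<in> Hm E W X" "y \<in> Hm E W Y" "z \<in> Hm E W Z"
  shows "tm_sem [Z, Y, X] s \<cdot> \<langle>\<langle>\<langle>bang W, x\<rangle>, y\<rangle>, z\<rangle> = tm_sem [Z, Y, X] t \<cdot> \<langle>\<langle>\<langle>bang W, x\<rangle>, y\<rangle>, z\<rangle>"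
proof -
  have W: "W \<in> Ob E" using assms(7) by (rule Hm_Ob)
  note t3 = fm_sem_Eq_Hm[OF assms(5,6)]
  have t2: "fm_sem [Y, X] (All Z (Eq s t)) \<in> Hm E (ctx [Y, X]) \<Omega>"
    by (rule fm_sem_All_Hm[OF _ t3]) (use assms(2-4) in simp)
  have t1: "fm_sem [X] (All Y (All Z (Eq s t))) \<in> Hm E (ctx [X]) \<Omega>"
    by (rule fm_sem_All_Hm[OF _ t2]) (use assms(2,3) in simp)
  have h: "bang W \<in> Hm E W (ctx [])" "\<langle>bang W, x\<rangle> \<in> Hm E W (ctx [X])"
      "\<langle>\<langle>bang W, x\<rangle>, y\<rangle> \<in> Hm E W (ctx [Y, X])" "\<langle>\<langle>\<langle>bang W, x\<rangle>, y\<rangle>, z\<rangle> \<in> Hm E W (ctx [Z, Y, X])"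
    using assms(7-9) W by (simp_all add: Hm_iff)
  have "forces [X] \<langle>bang W, x\<rangle> (All Y (All Z (Eq s t)))"
    by (rule forces_AllD[OF valid_forces[OF assms(1) W] _ t1 h(1) assms(7)]) (use assms(2) in simp)
  then have "forces [Y, X] \<langle>\<langle>bang W, x\<rangle>, y\<rangle> (All Z (Eq s t))"
    by (rule forces_AllD[OF _ _ t2 h(2) assms(8)]) (use assms(2,3) in simp)
  then have "forces [Z, Y, X] \<langle>\<langle>\<langle>bang W, x\<rangle>, y\<rangle>, z\<rangle> (Eq s t)"
    by (rule forces_AllD[OF _ _ t3 h(3) assms(9)]) (use assms(2-4) in simp)
  then show ?thesis
    using forces_Eq_iff[OF assms(5,6) h(4)] by blast
qed

section \<open>Group laws for generalized elements\<close>

lemma ab_group_object_simps [simp]: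
  assumes "ab_group_object G"
  shows "car G \<in> Ob E" "gadd G \<in> Ar E" "Dom E (gadd G) = car G \<^bold>\<times> car G" "Cod E (gadd G) = car G"
  using assms by (simp_all add: ab_group_object_def Hm_iff)

lemma gadd_assoc:
  assumes "ab_group_object G" "a \<in> Hm E W (car G)" "b \<in> Hm E W (car G)" "c \<in> Hm E W (car G)"
  shows "gadd G \<cdot> \<langle>gadd G \<cdot> \<langle>a, b\<rangle>, c\<rangle> = gadd G \<cdot> \<langle>a, gadd G \<cdot> \<langle>b, c\<rangle>\<rangle>"
proof -
  have "valid (All (car G) (All (car G) (All (car G)
       (Eq (Plus G (Plus G (Var 2) (Var 1)) (Var 0)) (Plus G (Var 2) (Plus G (Var 1) (Var 0)))))))"
    using assms(1) by (simp add: ab_group_object_def)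
  \<comment> \<open>\<open>numeral_2_eq_2\<close> rewrites the index 2 into successor form, on which
    the recursion of \<open>var_sem\<close> can compute.\<close>
  from valid_All3_EqD[OF this, where K = "car G" and x = a and y = b and z = c and W = W] show ?thesis
    using assms Hm_Ob[OF assms(2)] by (simp add: Hm_iff numeral_2_eq_2)
qed

lemma gadd_comm:
  assumes "ab_group_object G" "a \<in> Hm E W (car G)" "b \<in> Hm E W (car G)"
  shows "gadd G \<cdot> \<langle>a, b\<rangle> = gadd G \<cdot> \<langle>b, a\<rangle>"
proof -
  have "valid (All (car G) (All (car G) (Eq (Plus G (Var 1) (Var 0)) (Plus G (Var 0) (Var 1)))))"
    using assms(1) by (simp add: ab_group_object_def)
  from valid_All2_EqD[OF this, where K = "car G" and x = a and y = b and W = W] show ?thesis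
    using assms Hm_Ob[OF assms(2)] by (simp add: Hm_iff)
qed

text \<open>The interchange law is what makes a pointwise sum of additive maps additive: it regroups
  \<open>(f(n) + f(n')) + (g(n) + g(n'))\<close> by arguments instead of by maps. Commutativity
  enters in the exchange of the two middle terms.\<close>

lemma gadd_medial:
  assumes G: "ab_group_object G"
    and "a \<in> Hm E W (car G)" "b \<in> Hm E W (car G)" "c \<in> Hm E W (car G)" "d \<in> Hm E W (car G)"
  shows "gadd G \<cdot> \<langle>gadd G \<cdot> \<langle>a, b\<rangle>, gadd G \<cdot> \<langle>c, d\<rangle>\<rangle> = gadd G \<cdot> \<langle>gadd G \<cdot> \<langle>a, c\<rangle>, gadd G \<cdot> \<langle>b, d\<rangle>\<rangle>"
proof -
  have cl: "gadd G \<cdot> \<langle>u, v\<rangle> \<in> Hm E W (car G)" if "u \<in> Hm E W (car G)" "v \<in> Hm E W (car G)" for u v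
    using that G by (simp add: Hm_iff)
  have "gadd G \<cdot> \<langle>gadd G \<cdot> \<langle>a, b\<rangle>, gadd G \<cdot> \<langle>c, d\<rangle>\<rangle> = gadd G \<cdot> \<langle>a, gadd G \<cdot> \<langle>gadd G \<cdot> \<langle>b, c\<rangle>, d\<rangle>\<rangle>"
    using assms cl by (simp add: gadd_assoc[OF G])
  also have "\<dots> = gadd G \<cdot> \<langle>a, gadd G \<cdot> \<langle>gadd G \<cdot> \<langle>c, b\<rangle>, d\<rangle>\<rangle>"
    using assms by (simp add: gadd_comm[OF G, of b W c])
  also have "\<dots> = gadd G \<cdot> \<langle>gadd G \<cdot> \<langle>a, c\<rangle>, gadd G \<cdot> \<langle>b, d\<rangle>\<rangle>"
    using assms cl by (simp add: gadd_assoc[OF G])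
  finally show ?thesis .
qed

section \<open>The subobject of additive maps and its generalized elements\<close>

text \<open>Factoring through the comprehension is truth of its formula at \<open>s\<close>, and
  forcing unwinds the two quantifiers. They introduce two successive changes of stage, which the
  final form merges into a single \<open>k\<close>. All three claims rest on the same typing of the
  formula and the same pullback, hence the joint statement.\<close>

lemma hom_incl_factor_iff:
  assumes N: "ab_group_object N" and P: "ab_group_object P"
  shows "hom_incl N P \<in> Hm E (hom_car N P) (Exp E (car N) (car P))" (is ?typ)
    and "is_mono (hom_incl N P)" (is ?mono)
    and "s \<in> Hm E W (Exp E (car N) (car P)) \<Longrightarrow>
      (\<exists>r. r \<in> Hm E W (hom_car N P) \<and> hom_incl N P \<cdot> r = s) \<longleftrightarrow>
      (\<forall>V k n n'. k \<in> Hm E V W \<longrightarrow> n \<in> Hm E V (car N) \<longrightarrow> n' \<in> Hm E V (car N) \<longrightarrow>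
        Ev E (car N) (car P) \<cdot> \<langle>s \<cdot> k, gadd N \<cdot> \<langle>n, n'\<rangle>\<rangle> =
        gadd P \<cdot> \<langle>Ev E (car N) (car P) \<cdot> \<langle>s \<cdot> k, n\<rangle>, Ev E (car N) (car P) \<cdot> \<langle>s \<cdot> k, n'\<rangle>\<rangle>)"
      (is "_ \<Longrightarrow> ?L \<longleftrightarrow> ?R")
proof -
  let ?n = "car N" and ?p = "car P"
  let ?K = "Exp E ?n ?p"
  let ?s = "App ?n ?p (Var 2) (Plus N (Var 1) (Var 0))"
  let ?t = "Plus P (App ?n ?p (Var 2) (Var 1)) (App ?n ?p (Var 2) (Var 0))"
  let ?\<phi> = "All ?n (All ?n (Eq ?s ?t))"
  let ?\<chi> = "fm_sem [?K] ?\<phi> \<cdot> \<langle>bang ?K, Id E ?K\<rangle>"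
  have st: "tm_sem [?n, ?n, ?K] ?s \<in> Hm E (ctx [?n, ?n, ?K]) ?p"
    "tm_sem [?n, ?n, ?K] ?t \<in> Hm E (ctx [?n, ?n, ?K]) ?p"
    using N P by (simp_all add: Hm_iff numeral_2_eq_2)
  note t2 = fm_sem_Eq_Hm[OF st]
  have t1: "fm_sem [?n, ?K] (All ?n (Eq ?s ?t)) \<in> Hm E (ctx [?n, ?K]) \<Omega>"
    by (rule fm_sem_All_Hm[OF _ t2]) (use N P in simp)
  have t0: "fm_sem [?K] ?\<phi> \<in> Hm E (ctx [?K]) \<Omega>"
    by (rule fm_sem_All_Hm[OF _ t1]) (use N P in simp)
  have \<chi>: "?\<chi> \<in> Hm E ?K \<Omega>"
    using t0 N P by (simp add: Hm_iff del: fm_sem.simps)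
  have incl: "hom_incl N P = Pb1 E ?\<chi> \<top>"
    unfolding hom_incl_def compr_def ..
  have pb: "is_pullback ?\<chi> \<top> (hom_incl N P) (Pb2 E ?\<chi> \<top>)"
    unfolding incl by (rule Pb_pullback[OF \<chi> Truth_Hm])
  have D\<chi>: "Dom E ?\<chi> = ?K" using \<chi> by (simp add: Hm_iff del: fm_sem.simps)
  note p = is_pullback_commutes[OF pb]
  show ?typ
    using p(1) unfolding D\<chi> hom_car_def .
  show ?mono
    unfolding is_mono_def
  proof (intro conjI allI impI)
    show "hom_incl N P \<in> Ar E" using p(1) by (simp add: Hm_iff)
    fix W u v
    assume uv: "u \<in> Hm E W (Dom E (hom_incl N P))" "v \<in> Hm E W (Dom E (hom_incl N P))"
      "hom_incl N P \<cdot> u = hom_incl N P \<cdot> v"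
    \<comment> \<open>The second leg ends in 1 and cannot separate \<open>u\<close> from
      \<open>v\<close>, so uniqueness of the mediating morphism already gives monicity.\<close>
    have q: "Pb2 E ?\<chi> \<top> \<cdot> u = bang W" "Pb2 E ?\<chi> \<top> \<cdot> v = bang W"
      using p(2) uv by (auto intro!: bang_unique simp: Hm_iff simp del: fm_sem.simps)
    have a: "hom_incl N P \<cdot> v \<in> Hm E W (Dom E ?\<chi>)"
      using p(1) uv by (simp add: Hm_iff del: fm_sem.simps)
    have b: "?\<chi> \<cdot> (hom_incl N P \<cdot> v) = \<top> \<cdot> bang W"
      using pullback_Truth_iff[OF pb a] uv(2) by blast
    have c: "bang W \<in> Hm E W (Dom E \<top>)"
      using bang_Hm Hm_Ob[OF uv(1)] by simp
    show "u = v"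
      using is_pullback_universal[OF pb a c b] uv q by (metis (no_types, lifting))
  qed
  show "?L \<longleftrightarrow> ?R" if s: "s \<in> Hm E W ?K"
  proof -
    have ob: "W \<in> Ob E" "?K \<in> Ob E" "?n \<in> Ob E" "?p \<in> Ob E"
      using Hm_Ob[OF s] N P by simp_all
    \<comment> \<open>The context with one variable is 1 times \<open>?K\<close>; \<open>b\<close>
      is \<open>s\<close> regarded as an element of it, which absorbs the morphism inserted by
      \<open>compr\<close>.\<close>
    define b where "b = \<langle>bang W, s\<rangle>"
    have b: "b \<in> Hm E W (ctx [?K])" using ob s by (simp add: b_def Hm_iff)
    have "?L \<longleftrightarrow> ?\<chi> \<cdot> s = \<top> \<cdot> bang W"
      using pullback_Truth_iff[OF pb, of s W] s D\<chi> by (simp add: hom_car_def del: fm_sem.simps)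
    also have "\<dots> \<longleftrightarrow> forces [?K] b ?\<phi>"
      using t0 ob s by (simp add: forces_def b_def Hm_iff del: fm_sem.simps)
    also have "\<dots> \<longleftrightarrow> (\<forall>V k n. k \<in> Hm E V W \<longrightarrow> n \<in> Hm E V ?n \<longrightarrow>
        forces [?n, ?K] \<langle>b \<cdot> k, n\<rangle> (All ?n (Eq ?s ?t)))"
      using ob by (intro forces_All_iff[OF _ t1 b]) simp
    also have "\<dots> \<longleftrightarrow> (\<forall>V k n. k \<in> Hm E V W \<longrightarrow> n \<in> Hm E V ?n \<longrightarrow>
        (\<forall>V' k' n'. k' \<in> Hm E V' V \<longrightarrow> n' \<in> Hm E V' ?n \<longrightarrow>
          forces [?n, ?n, ?K] \<langle>\<langle>b \<cdot> k, n\<rangle> \<cdot> k', n'\<rangle> (Eq ?s ?t)))" (is "_ \<longleftrightarrow> ?F")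
    proof -
      have "forces [?n, ?K] \<langle>b \<cdot> k, n\<rangle> (All ?n (Eq ?s ?t)) \<longleftrightarrow>
        (\<forall>V' k' n'. k' \<in> Hm E V' V \<longrightarrow> n' \<in> Hm E V' ?n \<longrightarrow>
          forces [?n, ?n, ?K] \<langle>\<langle>b \<cdot> k, n\<rangle> \<cdot> k', n'\<rangle> (Eq ?s ?t))"
        if "k \<in> Hm E V W" "n \<in> Hm E V ?n" for V k n
        using ob that b by (intro forces_All_iff[OF _ t2]) (simp_all add: Hm_iff)
      then show ?thesis by blast
    qed
    also have "\<dots> \<longleftrightarrow> ?R"
    proof -
      have eq: "forces [?n, ?n, ?K] \<langle>\<langle>b \<cdot> k, n\<rangle> \<cdot> k', n'\<rangle> (Eq ?s ?t) \<longleftrightarrow>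
        Ev E ?n ?p \<cdot> \<langle>s \<cdot> (k \<cdot> k'), gadd N \<cdot> \<langle>n \<cdot> k', n'\<rangle>\<rangle> =
        gadd P \<cdot> \<langle>Ev E ?n ?p \<cdot> \<langle>s \<cdot> (k \<cdot> k'), n \<cdot> k'\<rangle>, Ev E ?n ?p \<cdot> \<langle>s \<cdot> (k \<cdot> k'), n'\<rangle>\<rangle>"
        if "k \<in> Hm E V W" "n \<in> Hm E V ?n" "k' \<in> Hm E V' V" "n' \<in> Hm E V' ?n" for V k n V' k' n'
      proof -
        have "V \<in> Ob E" "V' \<in> Ob E" using that Hm_Ob by blast+
        then show ?thesis
          using that ob s N P
          by (subst forces_Eq_iff[OF st, where W = V']) (simp_all add: b_def Hm_iff numeral_2_eq_2)
      qed
      show ?thesis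
      proof (intro iffI allI impI)
        fix V k n n'
        assume F: ?F and kn: "k \<in> Hm E V W" "n \<in> Hm E V ?n" "n' \<in> Hm E V ?n"
        \<comment> \<open>Both arguments already live at stage \<open>V\<close>, so the second
          change of stage is the identity. In the converse direction the two changes are composed
          and the first argument is restricted along the second change.\<close>
        have i: "Id E V \<in> Hm E V V" using Id_Hm Hm_Ob kn(1) by blast
        show "Ev E ?n ?p \<cdot> \<langle>s \<cdot> k, gadd N \<cdot> \<langle>n, n'\<rangle>\<rangle> =
            gadd P \<cdot> \<langle>Ev E ?n ?p \<cdot> \<langle>s \<cdot> k, n\<rangle>, Ev E ?n ?p \<cdot> \<langle>s \<cdot> k, n'\<rangle>\<rangle>"
          using F[rule_format, OF kn(1,2) i kn(3)] eq[OF kn(1,2) i kn(3)] kn by (simp add: Hm_iff)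
      next
        fix V k n V' k' n'
        assume R: ?R
          and kn: "k \<in> Hm E V W" "n \<in> Hm E V ?n" "k' \<in> Hm E V' V" "n' \<in> Hm E V' ?n"
        show "forces [?n, ?n, ?K] \<langle>\<langle>b \<cdot> k, n\<rangle> \<cdot> k', n'\<rangle> (Eq ?s ?t)"
          unfolding eq[OF kn]
          by (rule R[rule_format, OF Comp_Hm[OF kn(3,1)] Comp_Hm[OF kn(3,2)] kn(4)])
      qed
    qed
    finally show ?thesis .
  qed
qed

lemma hom_incl_simps [simp]:
  assumes "ab_group_object N" "ab_group_object P"
  shows "hom_incl N P \<in> Ar E" "Dom E (hom_incl N P) = hom_car N P"
    "Cod E (hom_incl N P) = Exp E (car N) (car P)" "hom_car N P \<in> Ob E"
  using hom_incl_factor_iff(1)[OF assms] Hm_Ob(1)[OF hom_incl_factor_iff(1)[OF assms]]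
  by (simp_all add: Hm_iff)

lemma hom_app_simps [simp]:
  assumes "ab_group_object N" "ab_group_object P"
    and "f \<in> Ar E" "Cod E f = hom_car N P" "n \<in> Ar E" "Cod E n = car N" "Dom E f = Dom E n"
  shows "hom_app N P f n \<in> Ar E" "Dom E (hom_app N P f n) = Dom E n"
    "Cod E (hom_app N P f n) = car P"
    and "k \<in> Ar E \<Longrightarrow> Cod E k = Dom E n \<Longrightarrow> hom_app N P f n \<cdot> k = hom_app N P (f \<cdot> k) (n \<cdot> k)"
  using assms by (simp_all add: hom_app_def)

text \<open>The composite \<open>hom_incl N P \<cdot> f\<close> factors through the inclusion with
  \<open>f\<close> itself as witness, so the criterion applies to it; the identity is taken as the
  change of stage.\<close>

lemma hom_app_gadd:
  assumes "ab_group_object N" "ab_group_object P"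
    and "f \<in> Hm E W (hom_car N P)" "n \<in> Hm E W (car N)" "n' \<in> Hm E W (car N)"
  shows "hom_app N P f (gadd N \<cdot> \<langle>n, n'\<rangle>) = gadd P \<cdot> \<langle>hom_app N P f n, hom_app N P f n'\<rangle>"
proof -
  have W: "W \<in> Ob E" using assms(3) by (rule Hm_Ob)
  have s: "hom_incl N P \<cdot> f \<in> Hm E W (Exp E (car N) (car P))"
    using assms by (simp add: Hm_iff)
  have "\<exists>r. r \<in> Hm E W (hom_car N P) \<and> hom_incl N P \<cdot> r = hom_incl N P \<cdot> f"
    using assms(3) by blast
  from this[unfolded hom_incl_factor_iff(3)[OF assms(1,2) s], rule_format,
      OF Id_Hm[OF W] assms(4,5)]
  show ?thesis using assms by (simp add: hom_app_def Hm_iff)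
qed

text \<open>Monicity of the inclusion moves the question to the full internal hom, where
  \<open>Exp_ext\<close> answers it.\<close>

lemma hom_ext:
  assumes "ab_group_object N" "ab_group_object P"
    and "f \<in> Hm E W (hom_car N P)" "g \<in> Hm E W (hom_car N P)"
    and "hom_app N P (f \<cdot> Fst E W (car N)) (Snd E W (car N)) =
      hom_app N P (g \<cdot> Fst E W (car N)) (Snd E W (car N))"
  shows "f = g"
proof -
  have W: "W \<in> Ob E" using assms(3) by (rule Hm_Ob)
  have "hom_incl N P \<cdot> f = hom_incl N P \<cdot> g"
  proof (rule Exp_ext[of _ W "car N" "car P"])
    have "Ev E (car N) (car P) \<cdot> \<langle>(hom_incl N P \<cdot> h) \<cdot> Fst E W (car N), Snd E W (car N)\<rangle> =
        hom_app N P (h \<cdot> Fst E W (car N)) (Snd E W (car N))" if "h \<in> Hm E W (hom_car N P)" for h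
      using W assms(1,2) that by (simp add: hom_app_def Hm_iff)
    then show "Ev E (car N) (car P) \<cdot> \<langle>(hom_incl N P \<cdot> f) \<cdot> Fst E W (car N), Snd E W (car N)\<rangle> =
        Ev E (car N) (car P) \<cdot> \<langle>(hom_incl N P \<cdot> g) \<cdot> Fst E W (car N), Snd E W (car N)\<rangle>"
      using assms(3-5) by simp
  qed (use assms(1-4) in \<open>simp_all add: Hm_iff\<close>)
  then show ?thesis
    using hom_incl_factor_iff(2)[OF assms(1,2)] assms by (auto simp: is_mono_def)
qed

text \<open>This gives the \<open>THE\<close> in \<open>hom_lift\<close> its meaning: additivity of
  \<open>t\<close> provides the factor and monicity of the inclusion its uniqueness. The second part
  is the beta rule for \<open>[N,P]_Z\<close>.\<close>

lemma hom_abs: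
  assumes N: "ab_group_object N" and P: "ab_group_object P" and X: "X \<in> Ob E"
    and t: "t \<in> Hm E (X \<^bold>\<times> car N) (car P)"
    and additive: "\<And>V x n n'. x \<in> Hm E V X \<Longrightarrow> n \<in> Hm E V (car N) \<Longrightarrow> n' \<in> Hm E V (car N) \<Longrightarrow>
      t \<cdot> \<langle>x, gadd N \<cdot> \<langle>n, n'\<rangle>\<rangle> = gadd P \<cdot> \<langle>t \<cdot> \<langle>x, n\<rangle>, t \<cdot> \<langle>x, n'\<rangle>\<rangle>"
  shows "hom_abs N P X t \<in> Hm E X (hom_car N P)"
    and "x \<in> Hm E W X \<Longrightarrow> n \<in> Hm E W (car N) \<Longrightarrow>
      hom_app N P (hom_abs N P X t \<cdot> x) n = t \<cdot> \<langle>x, n\<rangle>"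
proof -
  let ?s = "curry X (car N) (car P) t"
  have s: "?s \<in> Hm E X (Exp E (car N) (car P))" using N P X t by (simp add: Hm_iff)
  \<comment> \<open>By \<open>Ev_curry\<close> the value of \<open>?s \<cdot> k\<close> at
    \<open>n\<close> is \<open>t \<cdot> \<langle>k, n\<rangle>\<close>, so the criterion becomes
    the hypothesis \<open>additive\<close> with \<open>k\<close> as the element
    \<open>x\<close>.\<close>
  have "\<exists>r. r \<in> Hm E X (hom_car N P) \<and> hom_incl N P \<cdot> r = ?s"
    unfolding hom_incl_factor_iff(3)[OF N P s]
    using additive N P X t by (simp add: Hm_iff)
  then have "\<exists>!r. r \<in> Hm E X (hom_car N P) \<and> hom_incl N P \<cdot> r = ?s"
    using hom_incl_factor_iff(2)[OF N P] N P by (auto simp: is_mono_def)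
  from theI'[OF this] have r: "hom_abs N P X t \<in> Hm E X (hom_car N P)"
    "hom_incl N P \<cdot> hom_abs N P X t = ?s"
    using s by (simp_all add: hom_abs_def hom_lift_def Hm_iff)
  show "hom_abs N P X t \<in> Hm E X (hom_car N P)" by (rule r)
  show "hom_app N P (hom_abs N P X t \<cdot> x) n = t \<cdot> \<langle>x, n\<rangle>"
    if "x \<in> Hm E W X" "n \<in> Hm E W (car N)"
  proof -
    have "hom_incl N P \<cdot> (hom_abs N P X t \<cdot> x) = ?s \<cdot> x"
      using that r N P by (simp add: Hm_iff flip: r(2))
    then show ?thesis using that N P X t by (simp add: hom_app_def Hm_iff)
  qed
qed

section \<open>Addition, scalar action and functoriality, computed on values\<close>

lemma hom_obj_gadd:
  assumes N: "ab_group_object N" and P: "ab_group_object P"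
  shows "gadd (hom_obj A N P) \<in> Hm E (hom_car N P \<^bold>\<times> hom_car N P) (hom_car N P)" (is ?typ)
    and "f \<in> Hm E W (hom_car N P) \<Longrightarrow> g \<in> Hm E W (hom_car N P) \<Longrightarrow> n \<in> Hm E W (car N) \<Longrightarrow>
      hom_app N P (gadd (hom_obj A N P) \<cdot> \<langle>f, g\<rangle>) n =
      gadd P \<cdot> \<langle>hom_app N P f n, hom_app N P g n\<rangle>"
proof -
  let ?H = "hom_car N P"
  let ?n = "car N"
  let ?t = "gadd P \<cdot> \<langle>hom_app N P (Fst E ?H ?H \<cdot> Fst E (?H \<^bold>\<times> ?H) ?n) (Snd E (?H \<^bold>\<times> ?H) ?n),
                      hom_app N P (Snd E ?H ?H \<cdot> Fst E (?H \<^bold>\<times> ?H) ?n) (Snd E (?H \<^bold>\<times> ?H) ?n)\<rangle>"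
  have gadd: "gadd (hom_obj A N P) = hom_abs N P (?H \<^bold>\<times> ?H) ?t"
    by (simp add: hom_obj_def Let_def)
  have X: "?H \<^bold>\<times> ?H \<in> Ob E" using N P by simp
  have t: "?t \<in> Hm E ((?H \<^bold>\<times> ?H) \<^bold>\<times> ?n) (car P)" using N P by (simp add: Hm_iff)
  have app: "?t \<cdot> \<langle>x, n\<rangle> = gadd P \<cdot> \<langle>hom_app N P (Fst E ?H ?H \<cdot> x) n, hom_app N P (Snd E ?H ?H \<cdot> x) n\<rangle>"
    if "x \<in> Hm E V (?H \<^bold>\<times> ?H)" "n \<in> Hm E V ?n" for V x n
    using that N P by (simp add: Hm_iff)
  have add: "?t \<cdot> \<langle>x, gadd N \<cdot> \<langle>n, n'\<rangle>\<rangle> = gadd P \<cdot> \<langle>?t \<cdot> \<langle>x, n\<rangle>, ?t \<cdot> \<langle>x, n'\<rangle>\<rangle>"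
    if x: "x \<in> Hm E V (?H \<^bold>\<times> ?H)" and n: "n \<in> Hm E V ?n" "n' \<in> Hm E V ?n" for V x n n'
  proof -
    have nn: "gadd N \<cdot> \<langle>n, n'\<rangle> \<in> Hm E V ?n" using n N by (simp add: Hm_iff)
    have u: "Fst E ?H ?H \<cdot> x \<in> Hm E V ?H" "Snd E ?H ?H \<cdot> x \<in> Hm E V ?H"
      using x N P by (simp_all add: Hm_iff)
    have "hom_app N P h k \<in> Hm E V (car P)" if "h \<in> Hm E V ?H" "k \<in> Hm E V ?n" for h k
      using that N P by (simp add: Hm_iff)
    then show ?thesis
      unfolding app[OF x n(1)] app[OF x n(2)] app[OF x nn]
        hom_app_gadd[OF N P u(1) n] hom_app_gadd[OF N P u(2) n]
      using u n by (intro gadd_medial[OF P]) blast+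
  qed
  show ?typ unfolding gadd by (rule hom_abs(1)[OF N P X t add])
  show "hom_app N P (gadd (hom_obj A N P) \<cdot> \<langle>f, g\<rangle>) n = gadd P \<cdot> \<langle>hom_app N P f n, hom_app N P g n\<rangle>"
    if "f \<in> Hm E W ?H" "g \<in> Hm E W ?H" "n \<in> Hm E W ?n"
  proof -
    have fg: "\<langle>f, g\<rangle> \<in> Hm E W (?H \<^bold>\<times> ?H)" using that by (simp add: Hm_iff)
    have "hom_app N P (gadd (hom_obj A N P) \<cdot> \<langle>f, g\<rangle>) n = ?t \<cdot> \<langle>\<langle>f, g\<rangle>, n\<rangle>"
      unfolding gadd by (rule hom_abs(2)[OF N P X t add fg that(3)])
    also have "\<dots> = gadd P \<cdot> \<langle>hom_app N P f n, hom_app N P g n\<rangle>"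
      unfolding app[OF fg that(3)] using that N P by (simp add: Hm_iff)
    finally show ?thesis .
  qed
qed

lemma left_module_act:
  assumes "ring_object A" "left_module A N"
  shows "act N \<in> Hm E (car A \<^bold>\<times> car N) (car N)"
    and "a \<in> Hm E W (car A) \<Longrightarrow> n \<in> Hm E W (car N) \<Longrightarrow> n' \<in> Hm E W (car N) \<Longrightarrow>
      act N \<cdot> \<langle>a, gadd N \<cdot> \<langle>n, n'\<rangle>\<rangle> = gadd N \<cdot> \<langle>act N \<cdot> \<langle>a, n\<rangle>, act N \<cdot> \<langle>a, n'\<rangle>\<rangle>"
proof -
  have A: "ab_group_object A" and N: "ab_group_object N"
    using assms by (simp_all add: ring_object_def left_module_def)
  show act: "act N \<in> Hm E (car A \<^bold>\<times> car N) (car N)"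
    using assms by (simp add: left_module_def)
  have "valid (All (car A) (All (car N) (All (car N)
       (Eq (Act N (Var 2) (Plus N (Var 1) (Var 0)))
           (Plus N (Act N (Var 2) (Var 1)) (Act N (Var 2) (Var 0)))))))"
    using assms by (simp add: left_module_def)
  note * = valid_All3_EqD[OF this, where K = "car N" and x = a and y = n and z = n' and W = W]
  show "act N \<cdot> \<langle>a, gadd N \<cdot> \<langle>n, n'\<rangle>\<rangle> = gadd N \<cdot> \<langle>act N \<cdot> \<langle>a, n\<rangle>, act N \<cdot> \<langle>a, n'\<rangle>\<rangle>"
    if "a \<in> Hm E W (car A)" "n \<in> Hm E W (car N)" "n' \<in> Hm E W (car N)"
    using A N Hm_Ob[OF that(1)] act that * by (simp add: Hm_iff numeral_2_eq_2)
qed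

text \<open>The body of the action is \<open>f(an)\<close>. It is additive in \<open>n\<close>
  because \<open>f\<close> is additive and scalar multiplication on \<open>N\<close> distributes
  over sums in \<open>N\<close>.\<close>

lemma hom_obj_act:
  assumes A: "ring_object A" and N: "left_module A N" and P: "ab_group_object P"
  shows "act (hom_obj A N P) \<in> Hm E (hom_car N P \<^bold>\<times> car A) (hom_car N P)" (is ?typ)
    and "f \<in> Hm E W (hom_car N P) \<Longrightarrow> a \<in> Hm E W (car A) \<Longrightarrow> n \<in> Hm E W (car N) \<Longrightarrow>
      hom_app N P (act (hom_obj A N P) \<cdot> \<langle>f, a\<rangle>) n = hom_app N P f (act N \<cdot> \<langle>a, n\<rangle>)"
proof -
  let ?H = "hom_car N P"
  let ?n = "car N"
  let ?a = "car A"
  let ?t = "hom_app N P (Fst E ?H ?a \<cdot> Fst E (?H \<^bold>\<times> ?a) ?n)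
          (act N \<cdot> \<langle>Snd E ?H ?a \<cdot> Fst E (?H \<^bold>\<times> ?a) ?n, Snd E (?H \<^bold>\<times> ?a) ?n\<rangle>)"
  have A': "ab_group_object A" and N': "ab_group_object N"
    using A N by (simp_all add: ring_object_def left_module_def)
  note actN = left_module_act[OF A N]
  have act: "act (hom_obj A N P) = hom_abs N P (?H \<^bold>\<times> ?a) ?t"
    by (simp add: hom_obj_def Let_def)
  have X: "?H \<^bold>\<times> ?a \<in> Ob E" using A' N' P by simp
  have t: "?t \<in> Hm E ((?H \<^bold>\<times> ?a) \<^bold>\<times> ?n) (car P)" using A' N' P actN(1) by (simp add: Hm_iff)
  have app: "?t \<cdot> \<langle>x, n\<rangle> = hom_app N P (Fst E ?H ?a \<cdot> x) (act N \<cdot> \<langle>Snd E ?H ?a \<cdot> x, n\<rangle>)"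
    if "x \<in> Hm E V (?H \<^bold>\<times> ?a)" "n \<in> Hm E V ?n" for V x n
    using that A' N' P actN(1) by (simp add: Hm_iff)
  have add: "?t \<cdot> \<langle>x, gadd N \<cdot> \<langle>n, n'\<rangle>\<rangle> = gadd P \<cdot> \<langle>?t \<cdot> \<langle>x, n\<rangle>, ?t \<cdot> \<langle>x, n'\<rangle>\<rangle>"
    if x: "x \<in> Hm E V (?H \<^bold>\<times> ?a)" and n: "n \<in> Hm E V ?n" "n' \<in> Hm E V ?n" for V x n n'
  proof -
    have nn: "gadd N \<cdot> \<langle>n, n'\<rangle> \<in> Hm E V ?n" using n N' by (simp add: Hm_iff)
    have u: "Fst E ?H ?a \<cdot> x \<in> Hm E V ?H" "Snd E ?H ?a \<cdot> x \<in> Hm E V ?a"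
      using x A' N' P by (simp_all add: Hm_iff)
    have an: "act N \<cdot> \<langle>Snd E ?H ?a \<cdot> x, k\<rangle> \<in> Hm E V ?n" if "k \<in> Hm E V ?n" for k
      using that u actN(1) by (simp add: Hm_iff)
    show ?thesis
      unfolding app[OF x n(1)] app[OF x n(2)] app[OF x nn] actN(2)[OF u(2) n]
      by (rule hom_app_gadd[OF N' P u(1) an[OF n(1)] an[OF n(2)]])
  qed
  show ?typ unfolding act by (rule hom_abs(1)[OF N' P X t add])
  show "hom_app N P (act (hom_obj A N P) \<cdot> \<langle>f, a\<rangle>) n = hom_app N P f (act N \<cdot> \<langle>a, n\<rangle>)"
    if "f \<in> Hm E W ?H" "a \<in> Hm E W ?a" "n \<in> Hm E W ?n"
  proof -
    have fa: "\<langle>f, a\<rangle> \<in> Hm E W (?H \<^bold>\<times> ?a)" using that by (simp add: Hm_iff)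
    have "hom_app N P (act (hom_obj A N P) \<cdot> \<langle>f, a\<rangle>) n = ?t \<cdot> \<langle>\<langle>f, a\<rangle>, n\<rangle>"
      unfolding act by (rule hom_abs(2)[OF N' P X t add fa that(3)])
    also have "\<dots> = hom_app N P f (act N \<cdot> \<langle>a, n\<rangle>)"
      unfolding app[OF fa that(3)] using that A' N' P by (simp add: Hm_iff)
    finally show ?thesis .
  qed
qed

lemma group_hom_gadd:
  assumes "ab_group_object G" "ab_group_object H" "g \<in> group_hom G H"
    and "a \<in> Hm E W (car G)" "b \<in> Hm E W (car G)"
  shows "g \<cdot> (gadd G \<cdot> \<langle>a, b\<rangle>) = gadd H \<cdot> \<langle>g \<cdot> a, g \<cdot> b\<rangle>"
proof -
  have g: "g \<in> Hm E (car G) (car H)" "g \<cdot> gadd G = gadd H \<cdot> prod_map g g"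
    using assms(3) by (simp_all add: group_hom_def)
  have "g \<cdot> (gadd G \<cdot> \<langle>a, b\<rangle>) = (g \<cdot> gadd G) \<cdot> \<langle>a, b\<rangle>"
    using assms g(1) by (simp add: Hm_iff)
  also have "\<dots> = gadd H \<cdot> \<langle>g \<cdot> a, g \<cdot> b\<rangle>"
    unfolding g(2) using assms g(1) by (simp add: prod_map_def Hm_iff)
  finally show ?thesis .
qed

text \<open>A homomorphism applied after an additive map leaves it additive, so
  \<open>hom_abs\<close> covers \<open>[N,g]_Z\<close>. On values it is then application of
  \<open>g\<close>, which turns the naturality of \<open>\<Phi>\<close> into a statement about
  transposes.\<close>

lemma hom_app_hom_map:
  assumes N: "ab_group_object N" and P: "ab_group_object P" and Q: "ab_group_object Q"
    and g: "g \<in> group_hom P Q"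
  shows "hom_map N P Q g \<in> Hm E (hom_car N P) (hom_car N Q)" (is ?typ)
    and "f \<in> Hm E W (hom_car N P) \<Longrightarrow> n \<in> Hm E W (car N) \<Longrightarrow>
      hom_app N Q (hom_map N P Q g \<cdot> f) n = g \<cdot> hom_app N P f n"
proof -
  let ?H = "hom_car N P"
  let ?n = "car N"
  let ?t = "g \<cdot> hom_app N P (Fst E ?H ?n) (Snd E ?H ?n)"
  have map: "hom_map N P Q g = hom_abs N Q ?H ?t" by (simp add: hom_map_def Let_def)
  have g': "g \<in> Hm E (car P) (car Q)" using g by (simp add: group_hom_def)
  have X: "?H \<in> Ob E" using N P by simp
  have t: "?t \<in> Hm E (?H \<^bold>\<times> ?n) (car Q)" using N P Q g' by (simp add: Hm_iff)
  have app: "?t \<cdot> \<langle>x, n\<rangle> = g \<cdot> hom_app N P x n" if "x \<in> Hm E V ?H" "n \<in> Hm E V ?n" for V x n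
    using that N P Q g' by (simp add: Hm_iff)
  have add: "?t \<cdot> \<langle>x, gadd N \<cdot> \<langle>n, n'\<rangle>\<rangle> = gadd Q \<cdot> \<langle>?t \<cdot> \<langle>x, n\<rangle>, ?t \<cdot> \<langle>x, n'\<rangle>\<rangle>"
    if x: "x \<in> Hm E V ?H" and n: "n \<in> Hm E V ?n" "n' \<in> Hm E V ?n" for V x n n'
  proof -
    have nn: "gadd N \<cdot> \<langle>n, n'\<rangle> \<in> Hm E V ?n" using n N by (simp add: Hm_iff)
    show ?thesis
      unfolding app[OF x n(1)] app[OF x n(2)] app[OF x nn] hom_app_gadd[OF N P x n]
      using x n N P by (intro group_hom_gadd[OF P Q g]) (simp_all add: Hm_iff)
  qed
  show ?typ unfolding map by (rule hom_abs(1)[OF N Q X t add])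
  show "hom_app N Q (hom_map N P Q g \<cdot> f) n = g \<cdot> hom_app N P f n"
    if fn: "f \<in> Hm E W ?H" "n \<in> Hm E W ?n"
    unfolding map app[OF fn, symmetric] by (rule hom_abs(2)[OF N Q X t add fn])
qed

lemma Id_group_hom:
  assumes "ab_group_object G"
  shows "Id E (car G) \<in> group_hom G G"
  using assms by (simp add: group_hom_def prod_map_def Hm_iff)

section \<open>Balanced products and the universal property of the tensor product\<close>

text \<open>The three laws of a balanced product have separate tasks. Additivity in \<open>N\<close>
  makes the transpose land in \<open>[N,P]_Z\<close>, additivity in \<open>M\<close> makes it a
  group homomorphism, and the law for scalars makes it linear over \<open>A\<close>.\<close>

lemma balanced_product_transpose:
  assumes A: "ring_object A" and M: "right_module A M" and N: "left_module A N"
    and P: "ab_group_object P" and f: "balanced_product A M N P f"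
  obtains u where "u \<in> right_module_hom A M (hom_obj A N P)"
    and "hom_app N P (u \<cdot> Fst E (car M) (car N)) (Snd E (car M) (car N)) = f"
proof -
  have A': "ab_group_object A" and M': "ab_group_object M" and N': "ab_group_object N"
    using A M N by (simp_all add: ring_object_def left_module_def right_module_def)
  have actM: "act M \<in> Hm E (car M \<^bold>\<times> car A) (car M)"
    using M by (simp add: right_module_def)
  note actN = left_module_act(1)[OF A N]
  have fH: "f \<in> Hm E (car M \<^bold>\<times> car N) (car P)"
    and v1: "valid (All (car M) (All (car M) (All (car N)
       (Eq (Fn f (Pair (Plus M (Var 2) (Var 1)) (Var 0)))
           (Plus P (Fn f (Pair (Var 2) (Var 0))) (Fn f (Pair (Var 1) (Var 0))))))))"
    and v2: "valid (All (car M) (All (car N) (All (car N)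
       (Eq (Fn f (Pair (Var 2) (Plus N (Var 1) (Var 0))))
           (Plus P (Fn f (Pair (Var 2) (Var 1))) (Fn f (Pair (Var 2) (Var 0))))))))"
    and v3: "valid (All (car M) (All (car A) (All (car N)
       (Eq (Fn f (Pair (Act M (Var 2) (Var 1)) (Var 0)))
           (Fn f (Pair (Var 2) (Act N (Var 1) (Var 0))))))))"
    using f by (simp_all add: balanced_product_def)
  note types = A' M' N' P actM actN fH
  have add1: "f \<cdot> \<langle>gadd M \<cdot> \<langle>x, y\<rangle>, n\<rangle> = gadd P \<cdot> \<langle>f \<cdot> \<langle>x, n\<rangle>, f \<cdot> \<langle>y, n\<rangle>\<rangle>"
    if "x \<in> Hm E W (car M)" "y \<in> Hm E W (car M)" "n \<in> Hm E W (car N)" for W x y n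
    using valid_All3_EqD[OF v1, where K = "car P" and x = x and y = y and z = n and W = W]
      that types Hm_Ob[OF that(1)] by (simp add: Hm_iff numeral_2_eq_2)
  have add2: "f \<cdot> \<langle>x, gadd N \<cdot> \<langle>n, n'\<rangle>\<rangle> = gadd P \<cdot> \<langle>f \<cdot> \<langle>x, n\<rangle>, f \<cdot> \<langle>x, n'\<rangle>\<rangle>"
    if "x \<in> Hm E W (car M)" "n \<in> Hm E W (car N)" "n' \<in> Hm E W (car N)" for W x n n'
    using valid_All3_EqD[OF v2, where K = "car P" and x = x and y = n and z = n' and W = W]
      that types Hm_Ob[OF that(1)] by (simp add: Hm_iff numeral_2_eq_2)
  have bal: "f \<cdot> \<langle>act M \<cdot> \<langle>x, a\<rangle>, n\<rangle> = f \<cdot> \<langle>x, act N \<cdot> \<langle>a, n\<rangle>\<rangle>"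
    if "x \<in> Hm E W (car M)" "a \<in> Hm E W (car A)" "n \<in> Hm E W (car N)" for W x a n
    using valid_All3_EqD[OF v3, where K = "car P" and x = x and y = a and z = n and W = W]
      that types Hm_Ob[OF that(1)] by (simp add: Hm_iff numeral_2_eq_2)
  define u where "u = hom_abs N P (car M) f"
  have ob: "car M \<in> Ob E" "car N \<in> Ob E" "car A \<in> Ob E" "hom_car N P \<in> Ob E" using types by simp_all
  have uH: "u \<in> Hm E (car M) (hom_car N P)"
    unfolding u_def by (rule hom_abs(1)[OF N' P ob(1) fH add2])
  have app: "hom_app N P (u \<cdot> x) n = f \<cdot> \<langle>x, n\<rangle>"
    if "x \<in> Hm E W (car M)" "n \<in> Hm E W (car N)" for W x n
    unfolding u_def by (rule hom_abs(2)[OF N' P ob(1) fH add2 that])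
  let ?H = "hom_obj A N P"
  note gaddH = hom_obj_gadd[OF N' P, where A = A] and actH = hom_obj_act[OF A N P]
  have "u \<cdot> gadd M = gadd ?H \<cdot> prod_map u u"
  proof (rule hom_ext[OF N' P])
    let ?W = "(car M \<^bold>\<times> car M) \<^bold>\<times> car N"
    let ?F = "Fst E (car M \<^bold>\<times> car M) (car N)"
    \<comment> \<open>These are the generic elements of \<open>M\<close>, \<open>M\<close> and
      \<open>N\<close> over \<open>?W\<close>. Once the projection \<open>?F\<close> is written as
      the pair of \<open>x\<close> and \<open>y\<close>, the equation required by
      \<open>hom_ext\<close> is additivity of \<open>f\<close> at \<open>x\<close>,
      \<open>y\<close>, \<open>n\<close>.\<close>
    define x y n where "x = Fst E (car M) (car M) \<cdot> ?F" and "y = Snd E (car M) (car M) \<cdot> ?F"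
      and "n = Snd E (car M \<^bold>\<times> car M) (car N)"
    have xyn: "x \<in> Hm E ?W (car M)" "y \<in> Hm E ?W (car M)" "n \<in> Hm E ?W (car N)"
      using ob by (simp_all add: x_def y_def n_def Hm_iff)
    have F: "?F = \<langle>x, y\<rangle>"
      by (rule prod_ext[of _ ?W "car M" "car M"]) (use ob in \<open>simp_all add: x_def y_def Hm_iff\<close>)
    have "hom_app N P ((u \<cdot> gadd M) \<cdot> ?F) n = hom_app N P (u \<cdot> (gadd M \<cdot> \<langle>x, y\<rangle>)) n"
      unfolding F using types uH xyn by (simp add: Hm_iff)
    also have "\<dots> = gadd P \<cdot> \<langle>f \<cdot> \<langle>x, n\<rangle>, f \<cdot> \<langle>y, n\<rangle>\<rangle>"
    proof -
      have "gadd M \<cdot> \<langle>x, y\<rangle> \<in> Hm E ?W (car M)" using xyn M' by (simp add: Hm_iff)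
      then show ?thesis using app xyn(3) add1[OF xyn] by metis
    qed
    also have "\<dots> = gadd P \<cdot> \<langle>hom_app N P (u \<cdot> x) n, hom_app N P (u \<cdot> y) n\<rangle>"
      by (simp add: app[OF xyn(1,3)] app[OF xyn(2,3)])
    also have "\<dots> = hom_app N P (gadd ?H \<cdot> \<langle>u \<cdot> x, u \<cdot> y\<rangle>) n"
      by (rule gaddH(2)[OF Comp_Hm[OF xyn(1) uH] Comp_Hm[OF xyn(2) uH] xyn(3), symmetric])
    also have "\<dots> = hom_app N P ((gadd ?H \<cdot> prod_map u u) \<cdot> ?F) n"
      unfolding F using gaddH(1) uH xyn ob by (simp add: Hm_iff prod_map_def)
    finally show "hom_app N P ((u \<cdot> gadd M) \<cdot> ?F) (Snd E (car M \<^bold>\<times> car M) (car N)) =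
      hom_app N P ((gadd ?H \<cdot> prod_map u u) \<cdot> ?F) (Snd E (car M \<^bold>\<times> car M) (car N))"
      unfolding n_def .
  qed (use types uH gaddH(1) ob in \<open>simp_all add: Hm_iff prod_map_def\<close>)
  moreover have "u \<cdot> act M = act ?H \<cdot> prod_map u (Id E (car A))"
  proof (rule hom_ext[OF N' P])
    let ?W = "(car M \<^bold>\<times> car A) \<^bold>\<times> car N"
    let ?F = "Fst E (car M \<^bold>\<times> car A) (car N)"
    define x a n where "x = Fst E (car M) (car A) \<cdot> ?F" and "a = Snd E (car M) (car A) \<cdot> ?F"
      and "n = Snd E (car M \<^bold>\<times> car A) (car N)"
    have xan: "x \<in> Hm E ?W (car M)" "a \<in> Hm E ?W (car A)" "n \<in> Hm E ?W (car N)"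
      using ob by (simp_all add: x_def a_def n_def Hm_iff)
    have F: "?F = \<langle>x, a\<rangle>"
      by (rule prod_ext[of _ ?W "car M" "car A"]) (use ob in \<open>simp_all add: x_def a_def Hm_iff\<close>)
    have "hom_app N P ((u \<cdot> act M) \<cdot> ?F) n = hom_app N P (u \<cdot> (act M \<cdot> \<langle>x, a\<rangle>)) n"
      unfolding F using types uH xan by (simp add: Hm_iff)
    \<comment> \<open>The scalar crosses from \<open>M\<close> to \<open>N\<close>. The next two
      equations read \<open>f(x, an)\<close> as the value of \<open>u(x)\<close> at
      \<open>an\<close>, which by definition of the action is the value of \<open>u(x)a\<close> at
      \<open>n\<close>.\<close>
    also have "\<dots> = f \<cdot> \<langle>x, act N \<cdot> \<langle>a, n\<rangle>\<rangle>"
    proof -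
      have "act M \<cdot> \<langle>x, a\<rangle> \<in> Hm E ?W (car M)" using xan actM by (simp add: Hm_iff)
      then show ?thesis using app xan(3) bal[OF xan] by metis
    qed
    also have "\<dots> = hom_app N P (u \<cdot> x) (act N \<cdot> \<langle>a, n\<rangle>)"
    proof -
      have "act N \<cdot> \<langle>a, n\<rangle> \<in> Hm E ?W (car N)" using xan actN by (simp add: Hm_iff)
      then show ?thesis using app xan(1) by metis
    qed
    also have "\<dots> = hom_app N P (act ?H \<cdot> \<langle>u \<cdot> x, a\<rangle>) n"
      by (rule actH(2)[OF Comp_Hm[OF xan(1) uH] xan(2,3), symmetric])
    also have "\<dots> = hom_app N P ((act ?H \<cdot> prod_map u (Id E (car A))) \<cdot> ?F) n"
      unfolding F using actH(1) uH xan ob by (simp add: Hm_iff prod_map_def)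
    finally show "hom_app N P ((u \<cdot> act M) \<cdot> ?F) (Snd E (car M \<^bold>\<times> car A) (car N)) =
      hom_app N P ((act ?H \<cdot> prod_map u (Id E (car A))) \<cdot> ?F) (Snd E (car M \<^bold>\<times> car A) (car N))"
      unfolding n_def .
  qed (use types uH actH(1) ob in \<open>simp_all add: Hm_iff prod_map_def\<close>)
  moreover have "car ?H = hom_car N P" by (simp add: hom_obj_def Let_def)
  ultimately have "u \<in> right_module_hom A M ?H"
    using uH by (simp add: right_module_hom_def group_hom_def)
  moreover have "hom_app N P (u \<cdot> Fst E (car M) (car N)) (Snd E (car M) (car N)) = f"
  proof -
    \<comment> \<open>At the two projections the pair in \<open>app\<close> is the identity of the
      product, so \<open>f\<close> itself is recovered.\<close>
    have "Fst E (car M) (car N) \<in> Hm E (car M \<^bold>\<times> car N) (car M)"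
      "Snd E (car M) (car N) \<in> Hm E (car M \<^bold>\<times> car N) (car N)"
      using ob by (simp_all add: Hm_iff)
    from app[OF this] show ?thesis using ob fH by (simp add: Hm_iff)
  qed
  ultimately show ?thesis by (rule that)
qed

lemma Comp_tensor_map:
  assumes M: "right_module A M" and N: "left_module A N" and rep: "represents A M N T \<Phi>"
    and P: "ab_group_object P" and g: "g \<in> group_hom T P"
  shows "\<Phi> P g \<in> Hm E (car M) (hom_car N P)"
    and "g \<cdot> tensor_map N T \<Phi> = hom_app N P (\<Phi> P g \<cdot> Fst E (car M) (car N)) (Snd E (car M) (car N))"
proof -
  have M': "ab_group_object M" and N': "ab_group_object N"
    using M N by (simp_all add: left_module_def right_module_def)
  have T: "ab_group_object T" using rep by (simp add: represents_def)
  \<comment> \<open>The target is kept general because the fact is needed twice: for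
    \<open>g\<close> into \<open>P\<close>, and for the identity of \<open>T\<close>, where it types
    the unit.\<close>
  have \<Phi>_Hm: "\<Phi> Q h \<in> Hm E (car M) (hom_car N Q)"
    if "ab_group_object Q" "h \<in> group_hom T Q" for Q h
  proof -
    have "\<Phi> Q \<in> iso (Hom_Z T Q) (Hom_A A M (hom_obj A N Q))"
      using rep that(1) by (simp add: represents_def)
    then have "\<Phi> Q h \<in> right_module_hom A M (hom_obj A N Q)"
      using that(2) by (auto simp: iso_def hom_def Hom_Z_def Hom_A_def)
    then show ?thesis
      by (simp add: right_module_hom_def group_hom_def hom_obj_def Let_def)
  qed
  show "\<Phi> P g \<in> Hm E (car M) (hom_car N P)" by (rule \<Phi>_Hm[OF P g])
  let ?\<eta> = "tensor_unit T \<Phi>"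
  have \<eta>: "?\<eta> \<in> Hm E (car M) (hom_car N T)"
    unfolding tensor_unit_def by (rule \<Phi>_Hm[OF T Id_group_hom[OF T]])
  have gH: "g \<in> Hm E (car T) (car P)" using g by (simp add: group_hom_def)
  have "\<Phi> P (g \<cdot> Id E (car T)) = hom_map N T P g \<cdot> ?\<eta>"
    using rep T P g Id_group_hom[OF T] unfolding represents_def tensor_unit_def by blast
  then have nat: "\<Phi> P g = hom_map N T P g \<cdot> ?\<eta>"
    using gH by (simp add: Hm_iff)
  have ob: "car M \<in> Ob E" "car N \<in> Ob E" using M' N' by simp_all
  have F: "?\<eta> \<cdot> Fst E (car M) (car N) \<in> Hm E (car M \<^bold>\<times> car N) (hom_car N T)"
    and S: "Snd E (car M) (car N) \<in> Hm E (car M \<^bold>\<times> car N) (car N)"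
    using ob \<eta> by (simp_all add: Hm_iff)
  \<comment> \<open>Unfolding \<open>prod_map\<close> shows the tensor map as the value of the unit
    at the two projections, so \<open>g\<close> can be moved inside as
    \<open>[N,g]_Z\<close>.\<close>
  have "g \<cdot> tensor_map N T \<Phi> = g \<cdot> hom_app N T (?\<eta> \<cdot> Fst E (car M) (car N)) (Snd E (car M) (car N))"
    using ob \<eta> N' T by (simp add: tensor_map_def hom_app_def prod_map_def Hm_iff)
  also have "\<dots> = hom_app N P (hom_map N T P g \<cdot> (?\<eta> \<cdot> Fst E (car M) (car N))) (Snd E (car M) (car N))"
    by (rule hom_app_hom_map(2)[OF N' T P g F S, symmetric])
  also have "hom_map N T P g \<cdot> (?\<eta> \<cdot> Fst E (car M) (car N)) = \<Phi> P g \<cdot> Fst E (car M) (car N)"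
    unfolding nat using hom_app_hom_map(1)[OF N' T P g] \<eta> ob by (simp add: Hm_iff)
  finally show "g \<cdot> tensor_map N T \<Phi> =
    hom_app N P (\<Phi> P g \<cdot> Fst E (car M) (car N)) (Snd E (car M) (car N))" .
qed

lemma balanced_product_factors_uniquely:
  assumes A: "ring_object A" and M: "right_module A M" and N: "left_module A N"
    and rep: "represents A M N T \<Phi>" and P: "ab_group_object P" and f: "balanced_product A M N P f"
  shows "\<exists>!g. g \<in> group_hom T P \<and> g \<cdot> tensor_map N T \<Phi> = f"
proof -
  have N': "ab_group_object N" using N by (simp add: left_module_def)
  have "\<Phi> P \<in> iso (Hom_Z T P) (Hom_A A M (hom_obj A N P))"
    using rep P by (simp add: represents_def)
  then have bij: "bij_betw (\<Phi> P) (group_hom T P) (right_module_hom A M (hom_obj A N P))"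
    by (simp add: iso_def Hom_Z_def Hom_A_def)
  note tensor = Comp_tensor_map[OF M N rep P]
  obtain u where u: "u \<in> right_module_hom A M (hom_obj A N P)"
    "hom_app N P (u \<cdot> Fst E (car M) (car N)) (Snd E (car M) (car N)) = f"
    by (rule balanced_product_transpose[OF A M N P f])
  have "u \<in> \<Phi> P ` group_hom T P" unfolding bij_betw_imp_surj_on[OF bij] by (rule u(1))
  then obtain g where g: "g \<in> group_hom T P" "\<Phi> P g = u" by (auto simp: image_iff)
  show ?thesis
  proof (intro ex1I[of _ g] conjI)
    show "g \<in> group_hom T P" "g \<cdot> tensor_map N T \<Phi> = f"
      using g u tensor(2)[OF g(1)] by simp_all
    fix k
    assume k: "k \<in> group_hom T P \<and> k \<cdot> tensor_map N T \<Phi> = f"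
    then have kT: "k \<in> group_hom T P" and kf: "k \<cdot> tensor_map N T \<Phi> = f" by simp_all
    \<comment> \<open>By \<open>hom_ext\<close> it suffices to compare values at the projections.
      For \<open>k\<close> this value is \<open>k \<cdot> tensor_map N T \<Phi>\<close>, for
      \<open>g\<close> it is the transpose of \<open>u\<close>, and both are
      \<open>f\<close>.\<close>
    have "\<Phi> P k = \<Phi> P g"
      by (rule hom_ext[OF N' P tensor(1)[OF kT] tensor(1)[OF g(1)]])
        (simp add: g(2) u(2) kf flip: tensor(2)[OF kT])
    then show "k = g"
      using inj_onD[OF bij_betw_imp_inj_on[OF bij]] kT g(1) by metis
  qed
qed

end

theorem propositionC6:
  fixes E :: "('o, 'm) topos_data"
    and A :: "('o, 'm) ring_obj"
    and M N :: "('o, 'm) mod_obj"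
    and T P :: "('o, 'm) ab_obj"
    and \<Phi> :: "('o, 'm) ab_obj \<Rightarrow> 'm \<Rightarrow> 'm"
    and f :: 'm
  assumes "topos E"
    and "\<And>A' M' N'. topos.ring_object E A' \<Longrightarrow> topos.right_module E A' M' \<Longrightarrow>
           topos.left_module E A' N' \<Longrightarrow> \<exists>T' \<Phi>'. topos.represents E A' M' N' T' \<Phi>'"
    and "topos.ring_object E A"
    and "topos.right_module E A M"
    and "topos.left_module E A N"
    and "topos.represents E A M N T \<Phi>"
    and "topos.ab_group_object E P"
    and "topos.balanced_product E A M N P f"
  shows "\<exists>!g. g \<in> topos.group_hom E T P \<and> Comp E g (topos.tensor_map E N T \<Phi>) = f"
  using topos.balanced_product_factors_uniquely[OF assms(1,3-8)] .

end
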